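(* For fixed integers $s,t$ and fixed $x,y>0$, $$\lim_{M,N\to\infty}\frac{1}{M^{1/\eta}N^{1/\theta}}K_c\!\left(s,\frac{x}{M^{1/\eta}N^{1/\theta}};t,\frac{y}{M^{1/\eta}N^{1/\theta}}\right)=K_{he}(s,x;t,y),$$ where $M,N\to\infty$ independently (with $M\le N$).
   Context: Fix $\alpha\ge0$, $\eta,\theta>0$. $s^+=\max(s,0)$, $s^-=\max(-s,0)$; $(u)_n=\prod_{0\le i<n}(u+i)$. For integers $1\le M\le N$, $$F_c(s,\zeta)=\frac{\theta^{N-s^+}}{\eta^{M-s^-}}\frac{(\frac{\alpha}{2\theta}+\frac{\zeta}{\theta}+s^++\frac12)_{N-s^+}}{(\frac{\alpha}{2\eta}-\frac{\zeta}{\eta}+s^-+\frac12)_{M-s^-}},\qquad F_{he}(s,\zeta)=\frac{\eta^{s^-}}{\theta^{s^+}}\frac{\Gamma(\frac{\alpha}{2\eta}-\frac{\zeta}{\eta}+s^-+\frac12)}{\Gamma(\frac{\alpha}{2\theta}+\frac{\zeta}{\theta}+s^++\frac12)}.$$ Fix $0<\delta<(\alpha+\min(\eta,\theta))/2$. $\Gamma_+$: ray from $+\infty-i\delta$ to $\delta-i\delta$, segment to $\delta+i\delta$, ray to $+\infty+i\delta$. $\Gamma_-$: ray from $-\infty-i\delta$ to $-\delta-i\delta$, segment to $-\delta+i\delta$, ray to $-\infty+i\delta$. For integers $s>t$, $R_c(s,t;\zeta)=\eta^{s^--t^-}\theta^{t^+-s^+}/[(\frac{\alpha}{2\theta}+\frac{\zeta}{\theta}+t^++\frac12)_{s^+-t^+}(\frac{\alpha}{2\eta}-\frac{\zeta}{\eta}+s^-+\frac12)_{t^--s^-}]$,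 with poles $p^-_i=-\frac\alpha2-\theta(t^++i+\frac12)$ ($0\le i<s^+-t^+$) and $p^+_i=\frac\alpha2+\eta(s^-+i+\frac12)$ ($0\le i<t^--s^-$). $V_c(s,x;t,y)$ ($x,y>0$) is $0$ if $s\le t$; for $s>t$ it is $(xy)^{-1/2}\frac1{2\pi i}\oint(x/y)^\zeta R_c(s,t;\zeta)d\zeta$ over a counterclockwise contour around all $p^-_i$ (no $p^+_i$) if $x>y$, and over a clockwise contour around all $p^+_i$ (no $p^-_i$) if $x\le y$. $$K_c(s,x;t,y)=\frac{1}{\sqrt{xy}}\int_{\Gamma_+}\frac{d\zeta}{2\pi i}\int_{\Gamma_-}\frac{d\omega}{2\pi i}\frac{F_c(s,\zeta)}{F_c(t,\omega)}\frac{x^\zeta}{y^\omega}\frac{1}{\zeta-\omega}-V_c(s,x;t,y)\quad(x,y\in(0,1)),$$ $$K_{he}(s,x;t,y)=\frac{1}{\sqrt{xy}}\int_{\Gamma_+}\frac{d\zeta}{2\pi i}\int_{\Gamma_-}\frac{d\omega}{2\pi i}\frac{F_{he}(s,\zeta)}{F_{he}(t,\omega)}\frac{x^\zeta}{y^\omega}\frac{1}{\zeta-\omega}-V_c(s,x;t,y)\quad(x,y>0).$$ ($K_c$ is the correlation kernel of the continuous Muttalib--Borodin process with parameters $\alpha,\eta,\theta,M,N$.) *)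

theory Defs
  imports "HOL-Complex_Analysis.Complex_Analysis"
begin

definition ppart :: "int \<Rightarrow> int" where "ppart s = max s 0"
definition npart :: "int \<Rightarrow> int" where "npart s = max (- s) 0"

definition F_c :: "real \<Rightarrow> real \<Rightarrow> real \<Rightarrow> nat \<Rightarrow> nat \<Rightarrow> int \<Rightarrow> complex \<Rightarrow> complex" where
  "F_c \<alpha> \<eta> \<theta> M N s \<zeta> =
     complex_of_real (\<theta> powi (int N - ppart s)) / complex_of_real (\<eta> powi (int M - npart s))
     * pochhammer (complex_of_real (\<alpha> / (2*\<theta>)) + \<zeta> / complex_of_real \<theta> + of_int (ppart s) + 1/2)
                  (nat (int N - ppart s))
     / pochhammer (complex_of_real (\<alpha> / (2*\<eta>)) - \<zeta> / complex_of_real \<eta> + of_int (npart s) + 1/2)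
                  (nat (int M - npart s))"

definition F_he :: "real \<Rightarrow> real \<Rightarrow> real \<Rightarrow> int \<Rightarrow> complex \<Rightarrow> complex" where
  "F_he \<alpha> \<eta> \<theta> s \<zeta> =
     complex_of_real (\<eta> powi npart s) / complex_of_real (\<theta> powi ppart s)
     * Gamma (complex_of_real (\<alpha> / (2*\<eta>)) - \<zeta> / complex_of_real \<eta> + of_int (npart s) + 1/2)
     / Gamma (complex_of_real (\<alpha> / (2*\<theta>)) + \<zeta> / complex_of_real \<theta> + of_int (ppart s) + 1/2)"

definition Gplus_integral :: "real \<Rightarrow> (complex \<Rightarrow> complex) \<Rightarrow> complex" where
  "Gplus_integral \<delta> f =
     - integral {\<delta>..} (\<lambda>u. f (Complex u (-\<delta>)))
     + integral {-\<delta>..\<delta>} (\<lambda>v. f (Complex \<delta> v) * \<i>)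
     + integral {\<delta>..} (\<lambda>u. f (Complex u \<delta>))"

definition Gminus_integral :: "real \<Rightarrow> (complex \<Rightarrow> complex) \<Rightarrow> complex" where
  "Gminus_integral \<delta> f =
     integral {..-\<delta>} (\<lambda>u. f (Complex u (-\<delta>)))
     + integral {-\<delta>..\<delta>} (\<lambda>v. f (Complex (-\<delta>) v) * \<i>)
     - integral {..-\<delta>} (\<lambda>u. f (Complex u \<delta>))"

definition R_c :: "real \<Rightarrow> real \<Rightarrow> real \<Rightarrow> int \<Rightarrow> int \<Rightarrow> complex \<Rightarrow> complex" where
  "R_c \<alpha> \<eta> \<theta> s t \<zeta> =
     complex_of_real (\<eta> powi (npart s - npart t) * \<theta> powi (ppart t - ppart s))
     / (pochhammer (complex_of_real (\<alpha> / (2*\<theta>)) + \<zeta> / complex_of_real \<theta> + of_int (ppart t) + 1/2)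
                   (nat (ppart s - ppart t))
        * pochhammer (complex_of_real (\<alpha> / (2*\<eta>)) - \<zeta> / complex_of_real \<eta> + of_int (npart s) + 1/2)
                   (nat (npart t - npart s)))"

text \<open>V_c.  For x > y: counterclockwise circle enclosing all poles
  p^-_i = -alpha/2 - theta (t^+ + i + 1/2), 0 <= i < m := s^+ - t^+ (centred at their midpoint,
  radius theta(2m-1)/4, hence contained in Re < 0 and away from all p^+_i; when m = 0 a
  circle enclosing no pole).  For x <= y: clockwise circle enclosing all
  p^+_i = alpha/2 + eta (s^- + i + 1/2), 0 <= i < n := t^- - s^-, lying in Re > 0.\<close>
definition V_c :: "real \<Rightarrow> real \<Rightarrow> real \<Rightarrow> int \<Rightarrow> real \<Rightarrow> int \<Rightarrow> real \<Rightarrow> complex" where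
  "V_c \<alpha> \<eta> \<theta> s x t y =
     (if s \<le> t then 0 else
      (let g = (\<lambda>\<zeta>. complex_of_real (x / y) powr \<zeta> * R_c \<alpha> \<eta> \<theta> s t \<zeta>);
           m = max (ppart s - ppart t) 1;
           n = max (npart t - npart s) 1;
           cm = complex_of_real (- \<alpha>/2 - \<theta> * (of_int (ppart t) + of_int m / 2));
           rm = \<theta> * (2 * of_int m - 1) / 4;
           cp = complex_of_real (\<alpha>/2 + \<eta> * (of_int (npart s) + of_int n / 2));
           rp = \<eta> * (2 * of_int n - 1) / 4
       in complex_of_real (1 / sqrt (x*y)) / (2 * complex_of_real pi * \<i>) *
          (if x > y then contour_integral (circlepath cm rm) g
           else contour_integral (reversepath (circlepath cp rp)) g)))"

definition K_c :: "real \<Rightarrow> real \<Rightarrow> real \<Rightarrow> real \<Rightarrow> nat \<Rightarrow> nat \<Rightarrow> int \<Rightarrow> real \<Rightarrow> int \<Rightarrow> real \<Rightarrow> complex" where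
  "K_c \<alpha> \<eta> \<theta> \<delta> M N s x t y =
     complex_of_real (1 / sqrt (x*y)) *
       Gplus_integral \<delta> (\<lambda>\<zeta>. Gminus_integral \<delta> (\<lambda>\<omega>.
          F_c \<alpha> \<eta> \<theta> M N s \<zeta> / F_c \<alpha> \<eta> \<theta> M N t \<omega>
          * complex_of_real x powr \<zeta> / complex_of_real y powr \<omega> / (\<zeta> - \<omega>)))
       / (2 * complex_of_real pi * \<i>)^2
     - V_c \<alpha> \<eta> \<theta> s x t y"

definition K_he :: "real \<Rightarrow> real \<Rightarrow> real \<Rightarrow> real \<Rightarrow> int \<Rightarrow> real \<Rightarrow> int \<Rightarrow> real \<Rightarrow> complex" where
  "K_he \<alpha> \<eta> \<theta> \<delta> s x t y =
     complex_of_real (1 / sqrt (x*y)) *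
       Gplus_integral \<delta> (\<lambda>\<zeta>. Gminus_integral \<delta> (\<lambda>\<omega>.
          F_he \<alpha> \<eta> \<theta> s \<zeta> / F_he \<alpha> \<eta> \<theta> t \<omega>
          * complex_of_real x powr \<zeta> / complex_of_real y powr \<omega> / (\<zeta> - \<omega>)))
       / (2 * complex_of_real pi * \<i>)^2
     - V_c \<alpha> \<eta> \<theta> s x t y"

end

theory Submission
  imports Defs
begin

text \<open>
  The map \<open>\<omega> \<mapsto> -\<omega>\<close> turns \<open>\<Gamma>\<^sub>-\<close> into \<open>\<Gamma>\<^sub>+\<close> and \<open>1 / F_c(t, \<omega>)\<close> into \<open>F_c(-t, -\<omega>)\<close> with
  \<open>(\<eta>, M)\<close> and \<open>(\<theta>, N)\<close> exchanged, so only \<open>F_c\<close> on \<open>\<Gamma>\<^sub>+\<close> has to be studied.  Up to a constant that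
  cancels in the kernel, \<open>F_c(s, \<zeta>) (x/L)\<^sup>\<zeta>\<close> with \<open>L = M powr (1/\<eta>) * N powr (1/\<theta>)\<close> is a rational factor
  independent of \<open>M, N\<close> times \<open>x\<^sup>\<zeta> G\<^sub>M(b) / G\<^sub>N(a)\<close>, where \<open>G\<^sub>n\<close> is Gauss's product converging to the
  Gamma function, \<open>a = \<alpha>/2\<theta> + \<zeta>/\<theta> + 1/2\<close> and \<open>b = \<alpha>/2\<eta> - \<zeta>/\<eta> + 1/2\<close>.  This yields the pointwise limit.
  For dominated convergence, \<open>G\<^sub>M(b)\<close> grows at most exponentially in \<open>Re \<zeta>\<close>, uniformly in \<open>M\<close>, whereas
  \<open>1 / G\<^sub>N(a)\<close> is, uniformly in \<open>N \<ge> K\<close>, at most a polynomial times \<open>K powr (- Re \<zeta> / \<theta>)\<close>, which for large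
  \<open>K\<close> beats any given exponential.
\<close>

section \<open>Integrals over the contours\<close>

text \<open>Extension by zero reduces the claim to boxes, where reflection is known. Balls about 0
  are symmetric, so the same \<open>B\<close> serves for the reflected function.\<close>

lemma has_integral_reflect_set:
  fixes f :: "real \<Rightarrow> 'a::banach"
  assumes "(f has_integral I) S"
  shows "((\<lambda>x. f (- x)) has_integral I) {x. - x \<in> S}"
proof -
  let ?g = "\<lambda>x. if x \<in> S then f x else 0"
  let ?h = "\<lambda>x. if x \<in> {x. - x \<in> S} then f (- x) else 0"
  have h: "?h = (\<lambda>x. ?g (- x))"
    by simp
  have g1: "?g integrable_on cbox a b" for a b
    using assms by (subst (asm) has_integral_alt') blast
  have g2: "\<exists>B>0. \<forall>a b. ball 0 B \<subseteq> cbox a b \<longrightarrow> norm (integral (cbox a b) ?g - I) < e"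
    if "e > 0" for e
    using assms that by (subst (asm) has_integral_alt') blast
  have int_h: "integral (cbox a b) ?h = integral (cbox (- b) (- a)) ?g" for a b
    unfolding h using Henstock_Kurzweil_Integration.integral_reflect[of "- a" "- b" ?g] by simp
  show ?thesis
  proof (subst has_integral_alt', intro conjI allI impI)
    fix a b :: real
    show "?h integrable_on cbox a b"
      unfolding h
      using Henstock_Kurzweil_Integration.integrable_reflect[of ?g "- a" "- b"] g1 by simp
  next
    fix e :: real
    assume "e > 0"
    then obtain B where B: "B > 0"
      "\<And>a b. ball 0 B \<subseteq> cbox a b \<Longrightarrow> norm (integral (cbox a b) ?g - I) < e"
      using g2 by blast
    have "norm (integral (cbox a b) ?h - I) < e" if ab: "ball 0 B \<subseteq> cbox a b" for a b
    proof -
      have "ball 0 B \<subseteq> cbox (- b) (- a)"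
      proof
        fix z :: real assume "z \<in> ball 0 B"
        then have "- z \<in> ball 0 B" by simp
        then have "- z \<in> cbox a b" using ab by blast
        then show "z \<in> cbox (- b) (- a)" by auto
      qed
      then show ?thesis
        unfolding int_h by (rule B(2))
    qed
    then show "\<exists>B>0. \<forall>a b. ball 0 B \<subseteq> cbox a b \<longrightarrow> norm (integral (cbox a b) ?h - I) < e"
      using B(1) by blast
  qed
qed

text \<open>For \<delta> > 0 the first disjunct gives the two rays and the second the vertical
  segment. All pointwise hypotheses on integrands refer to this set.\<close>

definition Gplus_contour :: "real \<Rightarrow> complex set" where
  "Gplus_contour \<delta> = {z. \<delta> \<le> Re z \<and> \<bar>Im z\<bar> = \<delta> \<or> Re z = \<delta> \<and> \<bar>Im z\<bar> \<le> \<delta>}"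

lemma Gplus_contourD:
  assumes "z \<in> Gplus_contour \<delta>"
  shows "\<delta> \<le> Re z" "\<bar>Im z\<bar> \<le> \<delta>"
  using assms by (auto simp: Gplus_contour_def)

lemma mem_Gplus_contour_ray:
  "0 < \<delta> \<Longrightarrow> \<delta> \<le> u \<Longrightarrow> Complex u \<delta> \<in> Gplus_contour \<delta>"
  "0 < \<delta> \<Longrightarrow> \<delta> \<le> u \<Longrightarrow> Complex u (-\<delta>) \<in> Gplus_contour \<delta>"
  by (auto simp: Gplus_contour_def)

lemma mem_Gplus_contour_segment:
  "v \<in> {-\<delta>..\<delta>} \<Longrightarrow> Complex \<delta> v \<in> Gplus_contour \<delta>"
  by (auto simp: Gplus_contour_def)

lemma Gplus_integral_cong:
  assumes "0 < \<delta>" "\<And>z. z \<in> Gplus_contour \<delta> \<Longrightarrow> f z = g z"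
  shows "Gplus_integral \<delta> f = Gplus_integral \<delta> g"
  unfolding Gplus_integral_def
  using assms mem_Gplus_contour_ray[OF assms(1)] mem_Gplus_contour_segment[of _ \<delta>]
  by (intro arg_cong2[of _ _ _ _ "(+)"] arg_cong[of _ _ uminus] Henstock_Kurzweil_Integration.integral_cong)
    auto

lemma integral_reflect_halfline:
  fixes f :: "real \<Rightarrow> 'a::banach"
  shows "integral {..-c} f = integral {c..} (\<lambda>x. f (- x))"
proof -
  have *: "{x. - x \<in> {c..}} = {..-c}" "{x. - x \<in> {..-c}} = {c..}" for c :: real
    by auto
  \<comment> \<open>An equivalence for every \<open>I\<close> also covers the case where neither
    side is integrable and both integrals take the default value 0.\<close>
  have "(f has_integral I) {..-c} \<longleftrightarrow> ((\<lambda>x. f (- x)) has_integral I) {c..}" for I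
    using has_integral_reflect_set[of f I "{..-c}"]
      has_integral_reflect_set[of "\<lambda>x. f (- x)" I "{c..}"]
    unfolding * by auto
  then show ?thesis
    by (simp add: integral_def integrable_on_def)
qed

text \<open>Negation maps \<open>\<Gamma>\<^sub>-\<close> onto \<open>\<Gamma>\<^sub>+\<close> with
  reversed orientation; the reversal and the sign of d\<omega> = -dz cancel.\<close>

lemma Gminus_integral_eq_Gplus_integral:
  "Gminus_integral \<delta> f = Gplus_integral \<delta> (\<lambda>z. f (- z))"
proof -
  have c: "- Complex a b = Complex (- a) (- b)" for a b
    by (simp add: complex_eq_iff)
  have "integral {-\<delta>..\<delta>} (\<lambda>v. f (Complex (-\<delta>) v) * \<i>) =
      integral {-\<delta>..\<delta>} (\<lambda>v. f (Complex (-\<delta>) (- v)) * \<i>)"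
    using Henstock_Kurzweil_Integration.integral_reflect[of \<delta> "-\<delta>" "\<lambda>v. f (Complex (-\<delta>) v) * \<i>"]
    by simp
  then show ?thesis
    by (simp add: Gminus_integral_def Gplus_integral_def integral_reflect_halfline c)
qed

section \<open>Dominated convergence along the contour\<close>

lemma exp_neg_integrable_halfline: "(\<lambda>u::real. C * exp (- u)) integrable_on {c..}"
proof -
  have "(\<lambda>u::real. exp (- 1 * u)) integrable_on {c..}"
    by (rule integrable_on_exp_minus_to_infinity) simp
  then show ?thesis
    by (intro integrable_on_mult_right) simp
qed

lemma continuous_bounded_integrable_on:
  fixes f :: "real \<Rightarrow> complex"
  assumes "continuous_on S f" "h integrable_on S" "\<And>x. x \<in> S \<Longrightarrow> norm (f x) \<le> h x" "closed S"
  shows "f integrable_on S"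
  using assms
  by (intro measurable_bounded_by_integrable_imp_integrable[of f S h]
      continuous_imp_measurable_on_sets_lebesgue) auto

lemma continuous_on_Gplus_contour_compose:
  assumes "0 < \<delta>" "continuous_on (Gplus_contour \<delta>) f"
  shows "continuous_on {\<delta>..} (\<lambda>u. f (Complex u \<delta>))"
    and "continuous_on {\<delta>..} (\<lambda>u. f (Complex u (-\<delta>)))"
    and "continuous_on {-\<delta>..\<delta>} (\<lambda>v. f (Complex \<delta> v))"
  using assms
  by (auto intro!: continuous_intros continuous_on_compose2[of "Gplus_contour \<delta>" f]
      simp: mem_Gplus_contour_ray mem_Gplus_contour_segment)

text \<open>Dominated convergence on each of the three pieces: the majorant is integrable on the
  rays and constant on the segment, where Re z = \<delta>.\<close>

lemma Gplus_integral_dominated: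
  assumes "0 < \<delta>"
    and cont: "\<And>k. continuous_on (Gplus_contour \<delta>) (f k)"
    and bound: "\<And>k z. z \<in> Gplus_contour \<delta> \<Longrightarrow> norm (f k z) \<le> C * exp (- Re z)"
    and lim: "\<And>z. z \<in> Gplus_contour \<delta> \<Longrightarrow> (\<lambda>k. f k z) \<longlonglongrightarrow> g z"
  shows "(\<lambda>k. Gplus_integral \<delta> (f k)) \<longlonglongrightarrow> Gplus_integral \<delta> g"
proof -
  note c = continuous_on_Gplus_contour_compose[OF \<open>0 < \<delta>\<close> cont]
  note m = mem_Gplus_contour_ray[OF \<open>0 < \<delta>\<close>]
  have "(\<lambda>k. integral {\<delta>..} (\<lambda>u. f k (Complex u \<delta>))) \<longlonglongrightarrow> integral {\<delta>..} (\<lambda>u. g (Complex u \<delta>))"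
    by (rule dominated_convergence(2)[where h = "\<lambda>u. C * exp (- u)"])
      (use m lim bound[OF m(1)] in
        \<open>auto intro!: continuous_bounded_integrable_on[OF c(1) exp_neg_integrable_halfline]
          exp_neg_integrable_halfline\<close>)
  moreover have "(\<lambda>k. integral {\<delta>..} (\<lambda>u. f k (Complex u (-\<delta>))))
      \<longlonglongrightarrow> integral {\<delta>..} (\<lambda>u. g (Complex u (-\<delta>)))"
    by (rule dominated_convergence(2)[where h = "\<lambda>u. C * exp (- u)"])
      (use m lim bound[OF m(2)] in
        \<open>auto intro!: continuous_bounded_integrable_on[OF c(2) exp_neg_integrable_halfline]
          exp_neg_integrable_halfline\<close>)
  moreover have "(\<lambda>k. integral {-\<delta>..\<delta>} (\<lambda>v. f k (Complex \<delta> v) * \<i>))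
      \<longlonglongrightarrow> integral {-\<delta>..\<delta>} (\<lambda>v. g (Complex \<delta> v) * \<i>)"
    by (rule dominated_convergence(2)[where h = "\<lambda>u. C * exp (- \<delta>)"])
      (use lim bound[OF mem_Gplus_contour_segment] mem_Gplus_contour_segment[of _ \<delta>] in
        \<open>auto intro!: integrable_continuous_real continuous_intros c(3) tendsto_intros simp: norm_mult\<close>)
  ultimately show ?thesis
    unfolding Gplus_integral_def by (intro tendsto_intros)
qed

text \<open>The right-hand side is linear in \<open>C\<close>. With \<open>C\<close> proportional to
  exp (- Re z) it shows that the inner of two nested integrals decays in the outer variable.\<close>

lemma Gplus_integral_bound:
  assumes "0 < \<delta>"
    and cont: "continuous_on (Gplus_contour \<delta>) f"
    and bound: "\<And>z. z \<in> Gplus_contour \<delta> \<Longrightarrow> norm (f z) \<le> C * exp (- Re z)"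
  shows "norm (Gplus_integral \<delta> f) \<le>
    2 * integral {\<delta>..} (\<lambda>u. C * exp (- u)) + integral {-\<delta>..\<delta>} (\<lambda>u. C * exp (- \<delta>))"
proof -
  note c = continuous_on_Gplus_contour_compose[OF \<open>0 < \<delta>\<close> cont]
  note m = mem_Gplus_contour_ray[OF \<open>0 < \<delta>\<close>]
  have 1: "norm (integral {\<delta>..} (\<lambda>u. f (Complex u \<delta>))) \<le> integral {\<delta>..} (\<lambda>u. C * exp (- u))"
    by (rule integral_norm_bound_integral)
      (use bound[OF m(1)] in
        \<open>auto intro!: continuous_bounded_integrable_on[OF c(1) exp_neg_integrable_halfline]
          exp_neg_integrable_halfline\<close>)
  have 2: "norm (integral {\<delta>..} (\<lambda>u. f (Complex u (-\<delta>)))) \<le> integral {\<delta>..} (\<lambda>u. C * exp (- u))"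
    by (rule integral_norm_bound_integral)
      (use bound[OF m(2)] in
        \<open>auto intro!: continuous_bounded_integrable_on[OF c(2) exp_neg_integrable_halfline]
          exp_neg_integrable_halfline\<close>)
  have 3: "norm (integral {-\<delta>..\<delta>} (\<lambda>v. f (Complex \<delta> v) * \<i>)) \<le>
      integral {-\<delta>..\<delta>} (\<lambda>u. C * exp (- \<delta>))"
    by (rule integral_norm_bound_integral)
      (use bound[OF mem_Gplus_contour_segment] in
        \<open>auto intro!: integrable_continuous_real continuous_intros c(3) simp: norm_mult\<close>)
  have tri: "norm (- a + b + c) \<le> norm a + norm c + norm b" for a b c :: complex
    using norm_triangle_ineq[of "- a + b" c] norm_triangle_ineq[of "- a" b] by simp
  show ?thesis
    unfolding Gplus_integral_def mult_2 by (rule order_trans[OF tri add_mono[OF add_mono[OF 2 1] 3]])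
qed

text \<open>Keeps the denominator \<zeta> - \<omega>, which becomes z + w after negating \<omega>,
  away from zero.\<close>

lemma norm_add_Gplus_contour:
  assumes "z \<in> Gplus_contour \<delta>" "w \<in> Gplus_contour \<delta>"
  shows "2 * \<delta> \<le> norm (z + w)"
proof -
  have "2 * \<delta> \<le> Re (z + w)"
    using Gplus_contourD(1)[OF assms(1)] Gplus_contourD(1)[OF assms(2)] by simp
  also have "\<dots> \<le> norm (z + w)"
    by (rule complex_Re_le_cmod)
  finally show ?thesis .
qed

text \<open>Dominated convergence is applied twice. The inner integrals converge for fixed z and are
  bounded by \<open>E * B * exp (- Re z)\<close>, the majorant for the outer integral.\<close>

lemma Gplus_double_integral_tendsto:
  fixes f g :: "nat \<Rightarrow> complex \<Rightarrow> complex"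
  assumes "0 < \<delta>"
    and contf: "\<And>k. continuous_on (Gplus_contour \<delta>) (f k)"
    and contg: "\<And>k. continuous_on (Gplus_contour \<delta>) (g k)"
    and boundf: "\<And>k z. z \<in> Gplus_contour \<delta> \<Longrightarrow> norm (f k z) \<le> C * exp (- Re z)"
    and boundg: "\<And>k z. z \<in> Gplus_contour \<delta> \<Longrightarrow> norm (g k z) \<le> D * exp (- Re z)"
    and limf: "\<And>z. z \<in> Gplus_contour \<delta> \<Longrightarrow> (\<lambda>k. f k z) \<longlonglongrightarrow> f' z"
    and limg: "\<And>z. z \<in> Gplus_contour \<delta> \<Longrightarrow> (\<lambda>k. g k z) \<longlonglongrightarrow> g' z"
  shows "(\<lambda>k. Gplus_integral \<delta> (\<lambda>z. Gplus_integral \<delta> (\<lambda>w. f k z * g k w / (z + w))))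
    \<longlonglongrightarrow> Gplus_integral \<delta> (\<lambda>z. Gplus_integral \<delta> (\<lambda>w. f' z * g' w / (z + w)))"
proof -
  let ?\<Gamma> = "Gplus_contour \<delta>"
  have nz: "z + w \<noteq> 0" if "z \<in> ?\<Gamma>" "w \<in> ?\<Gamma>" for z w
    using norm_add_Gplus_contour[OF that] \<open>0 < \<delta>\<close> by auto
  have C: "0 \<le> C" and D: "0 \<le> D"
  proof -
    have m: "Complex \<delta> \<delta> \<in> ?\<Gamma>" using \<open>0 < \<delta>\<close> by (intro mem_Gplus_contour_ray) auto
    show "0 \<le> C" using order_trans[OF norm_ge_zero boundf[OF m]] by (simp add: zero_le_mult_iff)
    show "0 \<le> D" using order_trans[OF norm_ge_zero boundg[OF m]] by (simp add: zero_le_mult_iff)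
  qed
  define E where "E = C * D / (2 * \<delta>)"
  have bnd: "norm (f k z * g k w / (z + w)) \<le> E * exp (- Re z) * exp (- Re w)"
    if "z \<in> ?\<Gamma>" "w \<in> ?\<Gamma>" for k z w
  proof -
    have "norm (f k z * g k w / (z + w)) \<le> (C * exp (- Re z)) * (D * exp (- Re w)) / (2 * \<delta>)"
      unfolding norm_divide norm_mult
      using boundf[OF that(1)] boundg[OF that(2)] norm_add_Gplus_contour[OF that] \<open>0 < \<delta>\<close> C D
      by (intro frac_le mult_mono) auto
    then show ?thesis by (simp add: E_def mult_ac)
  qed
  have contw: "continuous_on ?\<Gamma> (\<lambda>w. f k z * g k w / (z + w))" if "z \<in> ?\<Gamma>" for k z
    using nz[OF that] by (intro continuous_intros contg) auto
  have contz: "continuous_on ?\<Gamma> (\<lambda>z. f k z * g k w / (z + w))" if "w \<in> ?\<Gamma>" for k w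
    using nz[OF _ that] by (intro continuous_intros contf) auto
  define B where "B = 2 * integral {\<delta>..} (\<lambda>u. exp (- u)) + integral {-\<delta>..\<delta>} (\<lambda>u. exp (- \<delta>))"
  show ?thesis
  proof (rule Gplus_integral_dominated[OF \<open>0 < \<delta>\<close>, where C = "E * B"])
    fix k
    show "continuous_on ?\<Gamma> (\<lambda>z. Gplus_integral \<delta> (\<lambda>w. f k z * g k w / (z + w)))"
    \<comment> \<open>Continuity of the inner integral in z is dominated convergence once more, now
      along points \<open>u n\<close> of the contour with k fixed.\<close>
    proof (rule continuous_on_sequentiallyI)
      fix u a assume u: "\<forall>n. u n \<in> ?\<Gamma>" "a \<in> ?\<Gamma>" "u \<longlonglongrightarrow> a"
      show "(\<lambda>n. Gplus_integral \<delta> (\<lambda>w. f k (u n) * g k w / (u n + w)))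
          \<longlonglongrightarrow> Gplus_integral \<delta> (\<lambda>w. f k a * g k w / (a + w))"
      proof (rule Gplus_integral_dominated[OF \<open>0 < \<delta>\<close>, where C = E])
        fix n w assume w: "w \<in> ?\<Gamma>"
        have "0 \<le> Re (u n)" using Gplus_contourD(1)[of "u n" \<delta>] u \<open>0 < \<delta>\<close> by force
        then have "E * exp (- Re (u n)) * exp (- Re w) \<le> E * 1 * exp (- Re w)"
          using C D \<open>0 < \<delta>\<close> by (intro mult_right_mono mult_left_mono) (auto simp: E_def)
        then show "norm (f k (u n) * g k w / (u n + w)) \<le> E * exp (- Re w)"
          using bnd[of "u n" w k] u w by simp
      next
        fix w assume w: "w \<in> ?\<Gamma>"
        show "(\<lambda>n. f k (u n) * g k w / (u n + w)) \<longlonglongrightarrow> f k a * g k w / (a + w)"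
          using contz[OF w, of k] u unfolding continuous_on_sequentially o_def by blast
      qed (use contw u in auto)
    qed
  next
    fix k z assume z: "z \<in> ?\<Gamma>"
    have "norm (Gplus_integral \<delta> (\<lambda>w. f k z * g k w / (z + w))) \<le>
      2 * integral {\<delta>..} (\<lambda>u. (E * exp (- Re z)) * exp (- u))
      + integral {-\<delta>..\<delta>} (\<lambda>u. (E * exp (- Re z)) * exp (- \<delta>))"
      by (rule Gplus_integral_bound[OF \<open>0 < \<delta>\<close> contw[OF z] bnd[OF z]])
    also have "\<dots> = E * B * exp (- Re z)"
      unfolding Henstock_Kurzweil_Integration.integral_mult_right by (simp add: B_def algebra_simps)
    finally show "norm (Gplus_integral \<delta> (\<lambda>w. f k z * g k w / (z + w))) \<le> E * B * exp (- Re z)" .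
  next
    fix z assume z: "z \<in> ?\<Gamma>"
    show "(\<lambda>k. Gplus_integral \<delta> (\<lambda>w. f k z * g k w / (z + w)))
        \<longlonglongrightarrow> Gplus_integral \<delta> (\<lambda>w. f' z * g' w / (z + w))"
      by (rule Gplus_integral_dominated[OF \<open>0 < \<delta>\<close>])
        (use contw[OF z] bnd[OF z] nz[OF z] in \<open>auto intro!: tendsto_intros limf limg z\<close>)
  qed
qed

section \<open>Uniform bounds for Gauss's product\<close>

lemma powr_one_plus_le:
  fixes p x :: real
  assumes "0 \<le> p" "p \<le> 1" "0 \<le> x"
  shows "(1 + x) powr p \<le> 1 + p * x"
proof -
  \<comment> \<open>Concavity of ln between 1 and 1 + x.\<close>
  have "(1 - p) * ln 1 + p * ln (1 + x) \<le> ln ((1 - p) *\<^sub>R 1 + p *\<^sub>R (1 + x))"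
    using assms by (intro concave_onD[OF ln_concave]) auto
  also have "(1 - p) *\<^sub>R 1 + p *\<^sub>R (1 + x) = 1 + p * x"
    by (simp add: algebra_simps)
  finally have "exp (p * ln (1 + x)) \<le> exp (ln (1 + p * x))"
    by simp
  then show ?thesis
    using assms by (simp add: powr_def add_pos_nonneg)
qed

text \<open>Follows from the previous inequality with exponent 1 / p at the point p * x.\<close>

lemma one_plus_le_powr:
  fixes p x :: real
  assumes "1 \<le> p" "0 \<le> x"
  shows "1 + p * x \<le> (1 + x) powr p"
proof -
  have "(1 + p * x) powr (1 / p) \<le> 1 + x"
    using powr_one_plus_le[of "1 / p" "p * x"] assms by simp
  then have "((1 + p * x) powr (1 / p)) powr p \<le> (1 + x) powr p"
    using assms by (intro powr_mono2) auto
  then show ?thesis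
    using assms by (simp add: powr_powr add_pos_nonneg)
qed

text \<open>For p < 1 Bernoulli's inequality points the other way; the second-order error of ln (1 +
  1/n) costs the factor exp (1/n^2), whose product over n converges.\<close>

lemma one_plus_div_le_powr_times_exp:
  fixes p :: real and n :: nat
  assumes "0 \<le> p" "0 < n"
  shows "1 + p / n \<le> (1 + 1 / n) powr p * exp (1 / n ^ 2)"
proof (cases "1 \<le> p")
  case True
  have "1 + p / n \<le> (1 + 1 / n) powr p * 1"
    using one_plus_le_powr[OF True, of "1 / n"] by simp
  also have "\<dots> \<le> (1 + 1 / n) powr p * exp (1 / n ^ 2)"
    by (intro mult_left_mono) auto
  finally show ?thesis .
next
  case False
  have "1 / n - (1 / n)\<^sup>2 \<le> ln (1 + 1 / real n)"
    using assms by (intro ln_one_plus_pos_lower_bound) auto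
  then have "p * (1 / n - (1 / n)\<^sup>2) \<le> p * ln (1 + 1 / real n)"
    using assms by (intro mult_left_mono)
  moreover have "p * (1 / n)\<^sup>2 \<le> 1 * (1 / n)\<^sup>2"
    using False by (intro mult_right_mono) auto
  ultimately have "p / n \<le> p * ln (1 + 1 / n) + 1 / n ^ 2"
    by (simp add: algebra_simps power_divide)
  then have "exp (p / n) \<le> exp (p * ln (1 + 1 / n) + 1 / n ^ 2)"
    by simp
  also have "\<dots> = (1 + 1 / n) powr p * exp (1 / n ^ 2)"
    using assms by (simp add: exp_add powr_def add_nonneg_eq_0_iff)
  finally show ?thesis
    using exp_ge_add_one_self[of "p / n"] by linarith
qed

text \<open>Finite-n form of Gamma z = Gamma (z + 1) / z; the term 1/n vanishes in the
  limit.\<close>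

lemma Gamma_series'_shift:
  fixes z :: "'a :: {banach, real_normed_field}"
  assumes "0 < n" "\<And>j. z + of_nat j \<noteq> 0"
  shows "Gamma_series' z n = Gamma_series' (z + 1) n * (1 / of_nat n + 1 / z)"
proof -
  have z: "z \<noteq> 0" "z + of_nat n \<noteq> 0"
    using assms(2)[of 0] assms(2)[of n] by auto
  have "pochhammer (z + 1) n = pochhammer z n * (z + of_nat n) / z"
    using pochhammer_rec[of z n] pochhammer_Suc[of z n] z by (simp add: field_simps)
  moreover have "exp ((z + 1) * of_real (ln (of_nat n))) = exp (z * of_real (ln (of_nat n))) * of_nat n"
  proof -
    have "exp ((z + 1) * of_real (ln (of_nat n))) =
        exp (z * of_real (ln (of_nat n))) * exp (of_real (ln (of_nat n)))"
      by (simp add: algebra_simps exp_add)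
    also have "exp (of_real (ln (of_nat n))) = (of_nat n :: 'a)"
      using \<open>0 < n\<close> by (simp add: exp_of_real)
    finally show ?thesis .
  qed
  moreover have "pochhammer z n \<noteq> 0"
    using assms(2) by (auto simp: pochhammer_prod)
  moreover have "1 / of_nat n + 1 / z = (z + of_nat n) / (of_nat n * z)"
    using z \<open>0 < n\<close> by (simp add: field_simps)
  ultimately show ?thesis
    unfolding Gamma_series'_def using z \<open>0 < n\<close> by simp
qed

section \<open>Bounds for Gauss's product and its reciprocal\<close>

lemma pochhammer_Re_le_norm_pochhammer:
  assumes "0 \<le> Re z"
  shows "pochhammer (Re z) n \<le> norm (pochhammer z n)"
  unfolding pochhammer_prod prod_norm[symmetric]
  using assms complex_Re_le_cmod[of "z + of_nat _"] by (intro prod_mono) auto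

lemma norm_exp_times_ln: "norm (exp (z * of_real (ln (of_nat n)))) = exp (Re z * ln (of_nat n))"
  for z :: complex
  by simp

lemma norm_Gamma_series'_le:
  assumes "0 < Re z"
  shows "norm (Gamma_series' z n) \<le> Gamma_series' (Re z) n"
  unfolding Gamma_series'_def norm_divide norm_mult norm_exp_times_ln
  using assms pochhammer_Re_le_norm_pochhammer[of z n] pochhammer_pos[of "Re z" n]
  by (auto intro!: frac_le)

text \<open>The recurrence in the index, on which the monotonicity arguments in n rest.\<close>

lemma Gamma_series'_Suc:
  fixes z :: "'a :: {banach, real_normed_field}"
  assumes "0 < n"
  shows "Gamma_series' z (Suc n) =
    Gamma_series' z n * exp (z * of_real (ln (1 + 1 / n))) / (1 + z / of_nat n)"
proof -
  have "ln (real (Suc n)) = ln (real n) + ln (1 + 1 / n)"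
    using assms by (subst ln_mult_pos[symmetric]) (auto simp: field_simps add_pos_pos)
  then have "exp (z * of_real (ln (of_nat (Suc n)))) =
      exp (z * of_real (ln (of_nat n))) * exp (z * of_real (ln (1 + 1 / n)))"
    by (simp only: of_real_add distrib_left exp_add)
  moreover have "(fact (Suc n - 1) :: 'a) = of_nat n * fact (n - 1)"
    using assms by (cases n) auto
  moreover have "pochhammer z (Suc n) = pochhammer z n * of_nat n * (1 + z / of_nat n)"
    using assms by (simp add: pochhammer_Suc field_simps)
  ultimately show ?thesis
    using assms unfolding Gamma_series'_def by simp
qed

text \<open>The value at n = 1 is exactly 1 / p, and by Bernoulli's inequality the product does not
  increase with n when p \<le> 1.\<close>

lemma Gamma_series'_real_le_inverse:
  fixes p :: real
  assumes "0 < p" "p \<le> 1" "0 < n"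
  shows "Gamma_series' p n \<le> 1 / p"
  using \<open>0 < n\<close>
proof (induction n rule: nat_induct_non_zero)
  case 1
  show ?case by (simp add: Gamma_series'_def)
next
  case (Suc n)
  have "exp (p * ln (1 + 1 / n)) \<le> 1 + p / n"
    using powr_one_plus_le[of p "1 / n"] assms Suc.hyps
    by (simp add: powr_def add_pos_nonneg split: if_splits)
  then have "exp (p * ln (1 + 1 / n)) / (1 + p / n) \<le> 1"
    using assms by (simp add: divide_le_eq add_pos_nonneg)
  moreover have "0 \<le> Gamma_series' p n"
    using assms pochhammer_pos[of p n] by (simp add: Gamma_series'_def)
  ultimately have "Gamma_series' p n * (exp (p * ln (1 + 1 / n)) / (1 + p / n)) \<le> Gamma_series' p n * 1"
    by (intro mult_left_mono)
  then show ?case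
    using Suc by (simp add: Gamma_series'_Suc)
qed

text \<open>The finite-n substitute for Gamma (p + 1) = p * Gamma p, obtained by dropping the
  positive term 1/n from the shift recurrence.\<close>

lemma Gamma_series'_real_plus_1_le:
  fixes p :: real
  assumes "0 < n" "0 < p"
  shows "Gamma_series' (p + 1) n \<le> Gamma_series' p n * p"
proof -
  have "Gamma_series' p n = Gamma_series' (p + 1) n * (1 / n + 1 / p)"
    using Gamma_series'_shift[of n p] assms by (simp add: add_nonneg_eq_0_iff)
  moreover have "Gamma_series' (p + 1) n * (1 / p) \<le> Gamma_series' (p + 1) n * (1 / n + 1 / p)"
    using assms pochhammer_pos[of "p + 1" n]
    by (intro mult_left_mono) (auto simp: Gamma_series'_def)
  ultimately have "Gamma_series' (p + 1) n * (1 / p) \<le> Gamma_series' p n"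
    by simp
  then show ?thesis
    using assms by (simp add: pos_divide_le_eq)
qed

text \<open>Unit steps lead down to (0, 1]. The intervals start beyond 1 because the bound 1 / p on
  (0, 1] is not uniform; the last step down cancels it against the factor p - 1.\<close>

lemma Gamma_series'_real_le_fact:
  fixes p :: real
  assumes "0 < n" "real (Suc k) < p" "p \<le> real (Suc k) + 1"
  shows "Gamma_series' p n \<le> fact (Suc k)"
  using assms(2,3)
proof (induction k arbitrary: p)
  case 0
  have "Gamma_series' (p - 1 + 1) n \<le> Gamma_series' (p - 1) n * (p - 1)"
    using 0 by (intro Gamma_series'_real_plus_1_le assms) auto
  also have "\<dots> \<le> 1 / (p - 1) * (p - 1)"
    using 0 assms(1) by (intro mult_right_mono Gamma_series'_real_le_inverse) auto
  finally show ?case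
    using 0 by simp
next
  case (Suc k)
  have "Gamma_series' (p - 1 + 1) n \<le> Gamma_series' (p - 1) n * (p - 1)"
    using Suc.prems by (intro Gamma_series'_real_plus_1_le assms) auto
  also have "\<dots> \<le> fact (Suc k) * (real (Suc k) + 1)"
    using Suc.prems by (intro mult_mono Suc.IH) auto
  finally show ?case
    by (simp add: mult_ac)
qed

text \<open>Shifting \<open>z\<close> to the right by one costs a factor \<open>\<bar>1/n + 1/z\<bar> \<le> 1 + 1/q\<close>, so that the bound
  grows at most exponentially as \<open>Re z \<rightarrow> -\<infinity>\<close>, uniformly in \<open>n\<close>.\<close>

lemma norm_Gamma_series'_le_shift:
  assumes "0 < n" "0 < q" "\<And>j. q \<le> norm (z + of_nat j)"
    and "real (Suc m) < Re z + real k" "Re z + real k \<le> real (Suc m) + 1"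
  shows "norm (Gamma_series' z n) \<le> fact (Suc m) * (1 + 1 / q) ^ k"
  using assms(3-5)
proof (induction k arbitrary: z)
  case 0
  have "norm (Gamma_series' z n) \<le> Gamma_series' (Re z) n"
    using 0 by (intro norm_Gamma_series'_le) auto
  also have "\<dots> \<le> fact (Suc m)"
    using 0 assms by (intro Gamma_series'_real_le_fact) auto
  finally show ?case by simp
next
  case (Suc k)
  have nz: "z + of_nat j \<noteq> 0" for j
    using Suc.prems(1)[of j] \<open>0 < q\<close> by auto
  have "q \<le> norm (z + 1 + of_nat j)" for j
    using Suc.prems(1)[of "Suc j"] by (simp add: add_ac)
  then have IH: "norm (Gamma_series' (z + 1) n) \<le> fact (Suc m) * (1 + 1 / q) ^ k"
    using Suc.prems by (intro Suc.IH) auto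
  have "norm (1 / of_nat n + 1 / z) \<le> 1 / n + 1 / norm z"
    using norm_triangle_ineq[of "1 / of_nat n" "1 / z"] by (simp add: norm_divide)
  also have "\<dots> \<le> 1 + 1 / q"
    using Suc.prems(1)[of 0] assms by (intro add_mono frac_le) auto
  finally have "norm (Gamma_series' (z + 1) n) * norm (1 / of_nat n + 1 / z)
      \<le> (fact (Suc m) * (1 + 1 / q) ^ k) * (1 + 1 / q)"
    using IH assms by (intro mult_mono) auto
  then show ?case
    using Gamma_series'_shift[OF \<open>0 < n\<close> nz] by (simp add: norm_mult mult_ac)
qed

lemma norm_Gamma_series'_exp_bound:
  assumes "0 < q"
  shows "\<exists>C c. 0 \<le> C \<and> 0 \<le> c \<and> (\<forall>n>0. \<forall>z. Re z \<le> R \<longrightarrow> (\<forall>j. q \<le> norm (z + of_nat j)) \<longrightarrow>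
    norm (Gamma_series' z n) \<le> C * exp (- c * Re z))"
proof -
  define m where "m = nat \<lceil>R\<rceil>"
  define c where "c = ln (1 + 1 / q)"
  have c: "0 \<le> c" using assms by (simp add: c_def)
  have ec: "exp c = 1 + 1 / q" using assms by (simp add: c_def add_pos_pos)
  have "norm (Gamma_series' z n) \<le> (fact (Suc m) * exp (c * (real m + 2))) * exp (- c * Re z)"
    if n: "0 < n" and z: "Re z \<le> R" "\<And>j. q \<le> norm (z + of_nat j)" for n z
  proof -
    \<comment> \<open>The number of unit shifts that move Re z into (m + 1, m + 2]; since Re z \<le>
      R \<le> m, the argument of \<open>nat\<close> is positive.\<close>
    define k where "k = nat (\<lfloor>real (Suc m) - Re z\<rfloor> + 1)"
    have "R \<le> real m" unfolding m_def by linarith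
    then have k: "real (Suc m) < Re z + real k" "Re z + real k \<le> real (Suc m) + 1"
      unfolding k_def using z(1) by linarith+
    have "norm (Gamma_series' z n) \<le> fact (Suc m) * (1 + 1 / q) ^ k"
      by (rule norm_Gamma_series'_le_shift[OF n assms z(2) k])
    also have "(1 + 1 / q) ^ k = exp (c * real k)"
      by (simp add: ec[symmetric] exp_of_nat2_mult)
    also have "fact (Suc m) * exp (c * real k) \<le> fact (Suc m) * exp (c * (real m + 2 - Re z))"
      using k c by (intro mult_left_mono) (auto intro!: mult_left_mono)
    also have "exp (c * (real m + 2 - Re z)) = exp (c * (real m + 2)) * exp (- c * Re z)"
      by (simp add: exp_add[symmetric] algebra_simps)
    finally show ?thesis
      by (simp only: mult.assoc)
  qed
  then show ?thesis
    using c by (intro exI[of _ "fact (Suc m) * exp (c * (real m + 2))"] exI[of _ c]) auto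
qed

text \<open>The quotients \<open>1 / Gamma_series' z n\<close> are essentially decreasing in \<open>n\<close> (Bernoulli's
  inequality), so each of them is controlled by an early one, which decays like \<open>n powr - Re z\<close>.\<close>

lemma norm_inverse_Gamma_series'_Suc:
  assumes "0 < n" "0 < Re z" "\<bar>Im z\<bar> \<le> q"
  shows "norm (1 / Gamma_series' z (Suc n)) \<le> norm (1 / Gamma_series' z n) * exp ((1 + q\<^sup>2) / n ^ 2)"
proof -
  let ?p = "Re z"
  have "norm (1 + z / of_nat n) ^ 2 = (1 + ?p / n)\<^sup>2 + (Im z)\<^sup>2 / n ^ 2"
    by (simp add: cmod_power2 power_divide)
  also have "\<dots> \<le> (1 + ?p / n)\<^sup>2 + (1 + ?p / n)\<^sup>2 * (q\<^sup>2 / n ^ 2)"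
  proof -
    have "(Im z)\<^sup>2 \<le> q\<^sup>2"
      using power_mono[OF assms(3), of 2] by simp
    moreover have "1 \<le> (1 + ?p / n)\<^sup>2"
      using assms by (intro one_le_power) auto
    ultimately have "1 * ((Im z)\<^sup>2 / n ^ 2) \<le> (1 + ?p / n)\<^sup>2 * (q\<^sup>2 / n ^ 2)"
      by (intro mult_mono divide_right_mono) auto
    then show ?thesis by simp
  qed
  also have "\<dots> = (1 + ?p / n)\<^sup>2 * (1 + q\<^sup>2 / n ^ 2)"
    by (simp add: algebra_simps)
  also have "\<dots> \<le> (1 + ?p / n)\<^sup>2 * (exp (q\<^sup>2 / n ^ 2))\<^sup>2"
  proof (intro mult_left_mono)
    have "1 + q\<^sup>2 / n ^ 2 \<le> exp (q\<^sup>2 / n ^ 2)"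
      by (rule exp_ge_add_one_self)
    also have "\<dots> \<le> exp (q\<^sup>2 / n ^ 2) ^ 2"
      by (simp add: power2_eq_square)
    finally show "1 + q\<^sup>2 / n ^ 2 \<le> (exp (q\<^sup>2 / n ^ 2))\<^sup>2" .
  qed auto
  also have "\<dots> = ((1 + ?p / n) * exp (q\<^sup>2 / n ^ 2))\<^sup>2"
    by (simp add: power_mult_distrib)
  finally have "norm (1 + z / of_nat n) \<le> (1 + ?p / n) * exp (q\<^sup>2 / n ^ 2)"
    using assms by (auto intro: power2_le_imp_le)
  also have "\<dots> \<le> ((1 + 1 / n) powr ?p * exp (1 / n ^ 2)) * exp (q\<^sup>2 / n ^ 2)"
    using assms one_plus_div_le_powr_times_exp[of ?p n] by (intro mult_right_mono) auto
  also have "\<dots> = exp (?p * ln (1 + 1 / n)) * exp ((1 + q\<^sup>2) / n ^ 2)"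
    using assms by (simp add: powr_def add_divide_distrib exp_add add_nonneg_eq_0_iff)
  finally have *: "norm (1 + z / of_nat n) \<le> exp (?p * ln (1 + 1 / n)) * exp ((1 + q\<^sup>2) / n ^ 2)" .
  have "norm (1 / Gamma_series' z (Suc n)) =
      norm (1 / Gamma_series' z n) * (norm (1 + z / of_nat n) / exp (?p * ln (1 + 1 / n)))"
    using assms(1) by (simp add: Gamma_series'_Suc norm_divide norm_mult)
  also have "\<dots> \<le> norm (1 / Gamma_series' z n) * exp ((1 + q\<^sup>2) / n ^ 2)"
    using * by (intro mult_left_mono) (auto simp: divide_le_eq mult_ac)
  finally show ?thesis .
qed

text \<open>Iterates the one-step estimate; the accumulated factors exp ((1 + q^2) / j^2) have a
  bounded product because the sum of 1/j^2 converges.\<close>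

lemma norm_inverse_Gamma_series'_le:
  assumes "0 < n\<^sub>0"
  shows "\<exists>C\<ge>0. \<forall>n\<ge>n\<^sub>0. \<forall>z. 0 < Re z \<longrightarrow> \<bar>Im z\<bar> \<le> q \<longrightarrow>
    norm (1 / Gamma_series' z n) \<le> C * norm (1 / Gamma_series' z n\<^sub>0)"
proof -
  have sm: "summable (\<lambda>j. 1 / real j ^ 2)"
    using inverse_power_summable[of 2, where 'a=real] by (simp add: inverse_eq_divide)
  \<comment> \<open>The sum starts at j = 0, where 1 / 0 = 0, instead of at
    \<open>n\<^sub>0\<close>; the additional terms only enlarge the bound.\<close>
  have step: "norm (1 / Gamma_series' z n) \<le>
      norm (1 / Gamma_series' z n\<^sub>0) * exp ((1 + q\<^sup>2) * (\<Sum>j<n. 1 / real j ^ 2))"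
    if "n\<^sub>0 \<le> n" "0 < Re z" "\<bar>Im z\<bar> \<le> q" for n z
    using that(1)
  proof (induction n rule: dec_induct)
    case base
    have "norm (1 / Gamma_series' z n\<^sub>0) * 1 \<le>
        norm (1 / Gamma_series' z n\<^sub>0) * exp ((1 + q\<^sup>2) * (\<Sum>j<n\<^sub>0. 1 / real j ^ 2))"
      by (intro mult_left_mono) (auto intro!: mult_nonneg_nonneg sum_nonneg)
    then show ?case by simp
  next
    case (step n)
    have "norm (1 / Gamma_series' z (Suc n)) \<le> norm (1 / Gamma_series' z n) * exp ((1 + q\<^sup>2) / n ^ 2)"
      using step that assms by (intro norm_inverse_Gamma_series'_Suc) auto
    also have "\<dots> \<le> (norm (1 / Gamma_series' z n\<^sub>0) * exp ((1 + q\<^sup>2) * (\<Sum>j<n. 1 / real j ^ 2)))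
        * exp ((1 + q\<^sup>2) / n ^ 2)"
      using step.IH by (intro mult_right_mono) auto
    also have "\<dots> = norm (1 / Gamma_series' z n\<^sub>0) * exp ((1 + q\<^sup>2) * (\<Sum>j<Suc n. 1 / real j ^ 2))"
      by (simp add: distrib_left exp_add)
    finally show ?case .
  qed
  show ?thesis
  proof (intro exI[of _ "exp ((1 + q\<^sup>2) * (\<Sum>j. 1 / real j ^ 2))"] conjI allI impI)
    fix n z assume nz: "n\<^sub>0 \<le> n" "0 < Re z" "\<bar>Im z\<bar> \<le> q"
    have "(\<Sum>j<n. 1 / real j ^ 2) \<le> (\<Sum>j. 1 / real j ^ 2)"
      by (rule sum_le_suminf[OF sm]) auto
    then have "exp ((1 + q\<^sup>2) * (\<Sum>j<n. 1 / real j ^ 2)) \<le> exp ((1 + q\<^sup>2) * (\<Sum>j. 1 / real j ^ 2))"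
      by (simp add: add_pos_nonneg)
    then have "norm (1 / Gamma_series' z n\<^sub>0) * exp ((1 + q\<^sup>2) * (\<Sum>j<n. 1 / real j ^ 2)) \<le>
        norm (1 / Gamma_series' z n\<^sub>0) * exp ((1 + q\<^sup>2) * (\<Sum>j. 1 / real j ^ 2))"
      by (intro mult_left_mono) auto
    then show "norm (1 / Gamma_series' z n) \<le>
        exp ((1 + q\<^sup>2) * (\<Sum>j. 1 / real j ^ 2)) * norm (1 / Gamma_series' z n\<^sub>0)"
      using step[OF nz] by (simp add: mult_ac)
  qed auto
qed

lemma norm_pochhammer_le:
  fixes z :: "'a :: real_normed_field"
  shows "norm (pochhammer z n) \<le> (norm z + real n) ^ n"
proof -
  have "norm (pochhammer z n) = (\<Prod>j=0..<n. norm (z + of_nat j))"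
    by (simp add: pochhammer_prod prod_norm)
  also have "\<dots> \<le> (\<Prod>j=0..<n. norm z + real n)"
  proof (intro prod_mono conjI)
    fix j assume "j \<in> {0..<n}"
    then show "norm (z + of_nat j) \<le> norm z + real n"
      using norm_triangle_ineq[of z "of_nat j"] by auto
  qed auto
  finally show ?thesis by simp
qed

text \<open>The factorial is at least 1, and n^z supplies decay in Re z at rate ln n, which a large
  n makes as strong as desired.\<close>

lemma norm_inverse_Gamma_series'_le_poly:
  fixes z :: complex
  assumes "0 < n"
  shows "norm (1 / Gamma_series' z n) \<le> (norm z + real n) ^ n * exp (- ln n * Re z)"
proof -
  have "norm (1 / Gamma_series' z n) = norm (pochhammer z n) / (fact (n - 1) * exp (Re z * ln n))"
    by (simp add: Gamma_series'_def norm_divide norm_mult)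
  also have "\<dots> \<le> (norm z + real n) ^ n / (1 * exp (Re z * ln n))"
    by (intro frac_le mult_right_mono norm_pochhammer_le) auto
  finally show ?thesis
    by (simp add: exp_minus field_simps)
qed

lemma affine_power_le_exp:
  fixes D E :: real
  assumes "0 \<le> D" "0 \<le> E"
  shows "\<exists>C\<ge>0. \<forall>r\<ge>0. (D + E * r) ^ m \<le> C * exp r"
proof (cases "m = 0")
  case True
  then show ?thesis by (intro exI[of _ 1]) auto
next
  case False
  show ?thesis
  proof (intro exI[of _ "(D + E * m) ^ m"] conjI allI impI)
    fix r :: real assume r: "0 \<le> r"
    \<comment> \<open>The added terms complete the product \<open>(D + E * m) * (1 + r / m)\<close>;
      the m-th power of \<open>exp (r / m)\<close> is then \<open>exp r\<close>.\<close>
    have "D + E * r \<le> D + E * r + (D * r / m + E * m)"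
      using assms r by simp
    also have "\<dots> = (D + E * m) * (1 + r / m)"
      using False by (simp add: field_simps)
    also have "\<dots> \<le> (D + E * m) * exp (r / m)"
      using assms by (intro mult_left_mono exp_ge_add_one_self) auto
    finally have "(D + E * r) ^ m \<le> ((D + E * m) * exp (r / m)) ^ m"
      using assms r by (intro power_mono) auto
    also have "\<dots> = (D + E * m) ^ m * exp r"
      using False by (simp add: power_mult_distrib exp_of_nat_mult[symmetric])
    finally show "(D + E * r) ^ m \<le> (D + E * m) ^ m * exp r" .
  qed (use assms in auto)
qed

section \<open>The kernels\<close>

text \<open>The points a and b of the overview are
  \<open>gamma_arg \<alpha> \<theta> \<zeta>\<close> and
  \<open>gamma_arg \<alpha> \<eta> (- \<zeta>)\<close>; using one function for both makes the
  exchange of \<eta> and \<theta> a renaming.\<close>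

definition gamma_arg :: "real \<Rightarrow> real \<Rightarrow> complex \<Rightarrow> complex" where
  "gamma_arg \<alpha> \<theta> \<zeta> = complex_of_real (\<alpha> / (2*\<theta>)) + \<zeta> / complex_of_real \<theta> + 1/2"

text \<open>The quotient of \<open>F_he\<close> at s by \<open>F_he\<close> at 0, by Gamma (z + m) =
  pochhammer z m * Gamma z.\<close>

definition shift_factor :: "real \<Rightarrow> real \<Rightarrow> real \<Rightarrow> int \<Rightarrow> complex \<Rightarrow> complex" where
  "shift_factor \<alpha> \<eta> \<theta> s \<zeta> =
     (of_real \<eta> ^ nat (npart s) * pochhammer (gamma_arg \<alpha> \<eta> (- \<zeta>)) (nat (npart s)))
     / (of_real \<theta> ^ nat (ppart s) * pochhammer (gamma_arg \<alpha> \<theta> \<zeta>) (nat (ppart s)))"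

text \<open>This is \<open>F_he\<close> with its Gamma functions, shifted back to s = 0, replaced by
  Gauss's products of index M and N.\<close>

definition F_norm :: "real \<Rightarrow> real \<Rightarrow> real \<Rightarrow> nat \<Rightarrow> nat \<Rightarrow> int \<Rightarrow> complex \<Rightarrow> complex" where
  "F_norm \<alpha> \<eta> \<theta> M N s \<zeta> = shift_factor \<alpha> \<eta> \<theta> s \<zeta>
     * Gamma_series' (gamma_arg \<alpha> \<eta> (- \<zeta>)) M / Gamma_series' (gamma_arg \<alpha> \<theta> \<zeta>) N"

text \<open>The part of \<open>F_c\<close> that depends on \<open>M, N\<close> but not on \<open>\<zeta>\<close>; it is inverted when \<open>(\<eta>, M)\<close> and
  \<open>(\<theta>, N)\<close> are exchanged.\<close>

definition F_scale :: "real \<Rightarrow> real \<Rightarrow> real \<Rightarrow> nat \<Rightarrow> nat \<Rightarrow> real" where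
  "F_scale \<alpha> \<eta> \<theta> M N = (\<theta> ^ N * fact (N - 1) * real N powr (\<alpha> / (2*\<theta>) + 1/2))
     / (\<eta> ^ M * fact (M - 1) * real M powr (\<alpha> / (2*\<eta>) + 1/2))"

section \<open>The Gamma arguments on the contour\<close>

lemma Re_gamma_arg: "Re (gamma_arg \<alpha> \<theta> z) = \<alpha> / (2*\<theta>) + Re z / \<theta> + 1/2"
  and Im_gamma_arg: "Im (gamma_arg \<alpha> \<theta> z) = Im z / \<theta>"
  by (simp_all add: gamma_arg_def)

lemma Re_gamma_arg_ge:
  assumes "0 \<le> \<alpha>" "0 < \<theta>" "0 < \<delta>" "z \<in> Gplus_contour \<delta>"
  shows "1/2 \<le> Re (gamma_arg \<alpha> \<theta> z)" "Re z / \<theta> \<le> Re (gamma_arg \<alpha> \<theta> z)"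
  using assms Gplus_contourD(1)[OF assms(4)] by (auto simp: Re_gamma_arg)

lemma norm_gamma_arg_le:
  assumes "0 \<le> \<alpha>" "0 < \<theta>" "0 < \<delta>" "z \<in> Gplus_contour \<delta>"
  shows "norm (gamma_arg \<alpha> \<theta> z) \<le> (\<alpha> / (2*\<theta>) + 1/2 + \<delta> / \<theta>) + 1 / \<theta> * Re z"
    and "norm (gamma_arg \<alpha> \<theta> (- z)) \<le> (\<alpha> / (2*\<theta>) + 1/2 + \<delta> / \<theta>) + 1 / \<theta> * Re z"
proof -
  have "norm z \<le> Re z + \<delta>"
    using cmod_le[of z] Gplus_contourD[OF assms(4)] assms(3) by linarith
  then have z: "norm z / \<theta> \<le> (Re z + \<delta>) / \<theta>"
    using assms by (intro divide_right_mono) auto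
  have "norm (gamma_arg \<alpha> \<theta> w) \<le> \<alpha> / (2*\<theta>) + norm w / \<theta> + 1/2" for w
    unfolding gamma_arg_def
    using norm_triangle_ineq[of "complex_of_real (\<alpha> / (2*\<theta>)) + w / complex_of_real \<theta>" "1/2"]
      norm_triangle_ineq[of "complex_of_real (\<alpha> / (2*\<theta>))" "w / complex_of_real \<theta>"] assms
    by (simp add: norm_divide norm_mult)
  from this[of z] this[of "- z"] z
  show "norm (gamma_arg \<alpha> \<theta> z) \<le> (\<alpha> / (2*\<theta>) + 1/2 + \<delta> / \<theta>) + 1 / \<theta> * Re z"
    and "norm (gamma_arg \<alpha> \<theta> (- z)) \<le> (\<alpha> / (2*\<theta>) + 1/2 + \<delta> / \<theta>) + 1 / \<theta> * Re z"
    by (simp_all add: add_divide_distrib)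
qed

text \<open>On the rays the imaginary part gives the distance \<delta> / \<eta>; on the segment the
  real part is at least the second entry of the minimum, since j \<ge> 0.\<close>

lemma gamma_arg_uminus_away_from_poles:
  assumes "0 < \<eta>" "0 < \<delta>" "z \<in> Gplus_contour \<delta>"
  shows "min (\<delta> / \<eta>) (\<alpha> / (2*\<eta>) + 1/2 - \<delta> / \<eta>) \<le> norm (gamma_arg \<alpha> \<eta> (- z) + of_nat j)"
proof -
  let ?w = "gamma_arg \<alpha> \<eta> (- z) + of_nat j"
  consider "\<bar>Im z\<bar> = \<delta>" | "Re z = \<delta>"
    using assms(3) by (auto simp: Gplus_contour_def)
  then show ?thesis
  proof cases
    case 1
    then have "\<bar>Im ?w\<bar> = \<delta> / \<eta>"
      using assms by (simp add: Im_gamma_arg)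
    then have "\<delta> / \<eta> \<le> norm ?w"
      using abs_Im_le_cmod[of ?w] by simp
    then show ?thesis by (rule min.coboundedI1)
  next
    case 2
    then have "\<alpha> / (2*\<eta>) + 1/2 - \<delta> / \<eta> \<le> Re ?w"
      using assms by (simp add: Re_gamma_arg)
    also have "\<dots> \<le> norm ?w"
      by (rule complex_Re_le_cmod)
    finally show ?thesis by (rule min.coboundedI2)
  qed
qed

lemma of_real_powr_eq_exp_ln:
  assumes "0 < r"
  shows "complex_of_real r powr z = exp (z * of_real (ln r))"
  using assms by (simp add: powr_def Ln_of_real)

section \<open>Uniform bound, limit and exact form of the factors\<close>

context
  fixes \<alpha> \<eta> \<theta> \<delta> :: real
  assumes pos: "0 \<le> \<alpha>" "0 < \<eta>" "0 < \<theta>" "0 < \<delta>" and \<delta>_less: "\<delta> < (\<alpha> + min \<eta> \<theta>) / 2"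
begin

text \<open>Here the bound on \<delta> enters: the segment stays to the left of the first pole
  (\<alpha> + \<eta>) / 2 of the Gamma factor in the numerator.\<close>

lemma pole_distance_pos: "0 < min (\<delta> / \<eta>) (\<alpha> / (2*\<eta>) + 1/2 - \<delta> / \<eta>)"
proof -
  have "2 * \<delta> < \<alpha> + \<eta>" using \<delta>_less by auto
  then have "(2 * \<delta>) / (2*\<eta>) < (\<alpha> + \<eta>) / (2*\<eta>)"
    using pos by (intro divide_strict_right_mono) auto
  then show ?thesis using pos by (simp add: add_divide_distrib)
qed

lemma gamma_arg_uminus_plus_nonzero:
  assumes "z \<in> Gplus_contour \<delta>"
  shows "gamma_arg \<alpha> \<eta> (- z) + of_nat j \<noteq> 0"
  using gamma_arg_uminus_away_from_poles[OF pos(2,4) assms, of \<alpha> j] pole_distance_pos by auto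

lemma gamma_arg_plus_nonzero:
  assumes "z \<in> Gplus_contour \<delta>"
  shows "gamma_arg \<alpha> \<theta> z + of_nat j \<noteq> 0"
proof
  assume "gamma_arg \<alpha> \<theta> z + of_nat j = 0"
  then have "Re (gamma_arg \<alpha> \<theta> z + of_nat j) = 0"
    by simp
  then show False
    using Re_gamma_arg_ge(1)[OF pos(1,3,4) assms] by simp
qed

lemma pochhammer_gamma_arg_nonzero:
  assumes "z \<in> Gplus_contour \<delta>"
  shows "pochhammer (gamma_arg \<alpha> \<eta> (- z)) n \<noteq> 0" "pochhammer (gamma_arg \<alpha> \<theta> z) n \<noteq> 0"
  using gamma_arg_uminus_plus_nonzero[OF assms] gamma_arg_plus_nonzero[OF assms]
  by (auto simp: pochhammer_prod)

lemma gamma_arg_notin_nonpos_Ints: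
  assumes "z \<in> Gplus_contour \<delta>"
  shows "gamma_arg \<alpha> \<eta> (- z) \<notin> \<int>\<^sub>\<le>\<^sub>0" "gamma_arg \<alpha> \<theta> z \<notin> \<int>\<^sub>\<le>\<^sub>0"
  using gamma_arg_uminus_plus_nonzero[OF assms] gamma_arg_plus_nonzero[OF assms]
  by (metis add.left_inverse nonpos_Ints_cases')+

text \<open>All factors except the reciprocal product grow at most exponentially, at rates known
  before \<open>K\<close> is chosen, so a large \<open>K\<close> outweighs them.\<close>

lemma F_norm_bound:
  assumes "0 < x"
  shows "\<exists>K C. \<forall>M N z. 0 < M \<longrightarrow> K \<le> N \<longrightarrow> z \<in> Gplus_contour \<delta> \<longrightarrow>
    norm (F_norm \<alpha> \<eta> \<theta> M N s z * complex_of_real x powr z) \<le> C * exp (- Re z)"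
proof -
  let ?a = "gamma_arg \<alpha> \<theta>" and ?b = "\<lambda>z. gamma_arg \<alpha> \<eta> (- z)"
  let ?m = "nat (npart s)" and ?p = "nat (ppart s)"
  obtain C1 c where C1: "0 \<le> C1" "0 \<le> c" and
    bound1: "\<And>n z. 0 < n \<Longrightarrow> Re z \<le> \<alpha> / (2*\<eta>) + 1/2 \<Longrightarrow>
      (\<And>j. min (\<delta> / \<eta>) (\<alpha> / (2*\<eta>) + 1/2 - \<delta> / \<eta>) \<le> norm (z + of_nat j)) \<Longrightarrow>
      norm (Gamma_series' z n) \<le> C1 * exp (- c * Re z)"
    using norm_Gamma_series'_exp_bound[OF pole_distance_pos, of "\<alpha> / (2*\<eta>) + 1/2"] by blast
  \<comment> \<open>The rates to beat are 1 from the shift factor, 1 from the polynomial in the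
    reciprocal product, c / \<eta> and ln x; the surplus 1 is the decay that remains.\<close>
  define \<kappa> where "\<kappa> = c / \<eta> + ln x + 3"
  \<comment> \<open>Large enough that the decay rate ln K / \<theta> in Re z is at least
    \<kappa>.\<close>
  define K where "K = nat \<lceil>exp (\<theta> * \<kappa>)\<rceil>"
  have expK: "exp (\<theta> * \<kappa>) \<le> real K"
    unfolding K_def by linarith
  then have K: "0 < K"
    using exp_gt_zero[of "\<theta> * \<kappa>"] by (metis less_le_trans of_nat_0_less_iff)
  have lnK: "\<kappa> \<le> ln K / \<theta>"
    using expK K pos by (simp add: ln_ge_iff[symmetric] field_simps)
  obtain C2 where C2: "0 \<le> C2" and bound2: "\<And>n z. K \<le> n \<Longrightarrow> 0 < Re z \<Longrightarrow> \<bar>Im z\<bar> \<le> \<delta> / \<theta> \<Longrightarrow>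
      norm (1 / Gamma_series' z n) \<le> C2 * norm (1 / Gamma_series' z K)"
    using norm_inverse_Gamma_series'_le[OF K, of "\<delta> / \<theta>"] by blast
  obtain C3 where C3: "0 \<le> C3" and bound3: "\<And>r. 0 \<le> r \<Longrightarrow>
      ((\<alpha> / (2*\<theta>) + 1/2 + \<delta> / \<theta> + K) + 1 / \<theta> * r) ^ K \<le> C3 * exp r"
    using affine_power_le_exp[of "\<alpha> / (2*\<theta>) + 1/2 + \<delta> / \<theta> + K" "1 / \<theta>" K] pos by auto
  obtain C4 where C4: "0 \<le> C4" and bound4: "\<And>r. 0 \<le> r \<Longrightarrow>
      ((\<alpha> / (2*\<eta>) + 1/2 + \<delta> / \<eta> + ?m) + 1 / \<eta> * r) ^ ?m \<le> C4 * exp r"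
    using affine_power_le_exp[of "\<alpha> / (2*\<eta>) + 1/2 + \<delta> / \<eta> + ?m" "1 / \<eta>" ?m] pos by auto
  define C5 where "C5 = \<eta> ^ ?m * C4 / (\<theta> ^ ?p * (1/2) ^ ?p)"
  have C5: "0 \<le> C5" using pos C4 by (simp add: C5_def)
  have "norm (F_norm \<alpha> \<eta> \<theta> M N s z * complex_of_real x powr z) \<le> (C5 * C1 * C2 * C3) * exp (- Re z)"
    if M: "0 < M" and N: "K \<le> N" and z: "z \<in> Gplus_contour \<delta>" for M N z
  proof -
    have Rez: "0 \<le> Re z" using Gplus_contourD(1)[OF z] pos by linarith
    note a = Re_gamma_arg_ge[OF pos(1,3,4) z]
    have g1: "norm (Gamma_series' (?b z) M) \<le> C1 * exp (c / \<eta> * Re z)"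
    proof -
      have "norm (Gamma_series' (?b z) M) \<le> C1 * exp (- c * Re (?b z))"
        using gamma_arg_uminus_away_from_poles[OF pos(2,4) z] Rez pos
        by (intro bound1 M) (auto simp: Re_gamma_arg)
      also have "\<dots> \<le> C1 * exp (c / \<eta> * Re z)"
      proof (intro mult_left_mono)
        have "0 \<le> c * (\<alpha> / (2*\<eta>) + 1/2)"
          using C1 pos by (intro mult_nonneg_nonneg) auto
        then show "exp (- c * Re (?b z)) \<le> exp (c / \<eta> * Re z)"
          by (simp add: Re_gamma_arg algebra_simps)
      qed (use C1 in auto)
      finally show ?thesis .
    qed
    have g2: "norm (1 / Gamma_series' (?a z) N) \<le> C2 * (C3 * exp (Re z) * exp (- \<kappa> * Re z))"
    proof -
      have "\<bar>Im (?a z)\<bar> \<le> \<delta> / \<theta>"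
        using Gplus_contourD(2)[OF z] pos by (simp add: Im_gamma_arg divide_right_mono)
      then have "norm (1 / Gamma_series' (?a z) N) \<le> C2 * norm (1 / Gamma_series' (?a z) K)"
        using a by (intro bound2 N) auto
      also have "norm (1 / Gamma_series' (?a z) K) \<le> (norm (?a z) + real K) ^ K * exp (- ln K * Re (?a z))"
        by (rule norm_inverse_Gamma_series'_le_poly[OF K])
      also have "\<dots> \<le> (C3 * exp (Re z)) * exp (- \<kappa> * Re z)"
      proof (intro mult_mono)
        have "(norm (?a z) + real K) ^ K \<le> ((\<alpha> / (2*\<theta>) + 1/2 + \<delta> / \<theta> + K) + 1 / \<theta> * Re z) ^ K"
          using norm_gamma_arg_le(1)[OF pos(1,3,4) z] by (intro power_mono) auto
        also have "\<dots> \<le> C3 * exp (Re z)"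
          by (rule bound3[OF Rez])
        finally show "(norm (?a z) + real K) ^ K \<le> C3 * exp (Re z)" .
        have "\<kappa> * Re z \<le> ln K / \<theta> * Re z"
          by (rule mult_right_mono[OF lnK Rez])
        also have "\<dots> = ln K * (Re z / \<theta>)"
          by simp
        also have "\<dots> \<le> ln K * Re (?a z)"
          using a(2) K by (intro mult_left_mono) auto
        finally show "exp (- ln K * Re (?a z)) \<le> exp (- \<kappa> * Re z)"
          by simp
      qed (use C3 in auto)
      finally show ?thesis
        using C2 by (simp add: mult_left_mono)
    qed
    have g3: "norm (shift_factor \<alpha> \<eta> \<theta> s z) \<le> C5 * exp (Re z)"
    proof -
      have "(1/2) ^ ?p \<le> norm (pochhammer (?a z) ?p)"
      proof -
        have "(1/2) ^ ?p = (\<Prod>j=0..<?p. 1/2 :: real)"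
          by simp
        also have "\<dots> \<le> (\<Prod>j=0..<?p. norm (?a z + of_nat j))"
        proof (intro prod_mono conjI)
          fix j
          have "1/2 \<le> Re (?a z + of_nat j)" using a(1) by simp
          also have "\<dots> \<le> norm (?a z + of_nat j)" by (rule complex_Re_le_cmod)
          finally show "1/2 \<le> norm (?a z + of_nat j)" .
        qed auto
        finally show ?thesis
          by (simp add: pochhammer_prod prod_norm)
      qed
      moreover have "norm (pochhammer (?b z) ?m) \<le> C4 * exp (Re z)"
      proof -
        have "norm (pochhammer (?b z) ?m) \<le> (norm (?b z) + real ?m) ^ ?m"
          by (rule norm_pochhammer_le)
        also have "\<dots> \<le> ((\<alpha> / (2*\<eta>) + 1/2 + \<delta> / \<eta> + ?m) + 1 / \<eta> * Re z) ^ ?m"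
          using norm_gamma_arg_le(2)[OF pos(1,2,4) z] by (intro power_mono) auto
        also have "\<dots> \<le> C4 * exp (Re z)"
          by (rule bound4[OF Rez])
        finally show ?thesis .
      qed
      ultimately have "\<eta> ^ ?m * norm (pochhammer (?b z) ?m) / (\<theta> ^ ?p * norm (pochhammer (?a z) ?p))
          \<le> \<eta> ^ ?m * (C4 * exp (Re z)) / (\<theta> ^ ?p * (1/2) ^ ?p)"
        using pos C4 by (intro frac_le mult_left_mono) auto
      then show ?thesis
        using pos by (simp add: shift_factor_def C5_def norm_divide norm_mult norm_power mult_ac)
    qed
    have g4: "norm (complex_of_real x powr z) = exp (ln x * Re z)"
      using assms by (simp add: powr_def mult_ac)
    have "norm (F_norm \<alpha> \<eta> \<theta> M N s z * complex_of_real x powr z) =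
        norm (shift_factor \<alpha> \<eta> \<theta> s z) * norm (Gamma_series' (?b z) M)
        * norm (1 / Gamma_series' (?a z) N) * norm (complex_of_real x powr z)"
      by (simp add: F_norm_def norm_mult norm_divide)
    also have "\<dots> \<le> (C5 * exp (Re z)) * (C1 * exp (c / \<eta> * Re z))
        * (C2 * (C3 * exp (Re z) * exp (- \<kappa> * Re z))) * exp (ln x * Re z)"
      unfolding g4 using C1 C2 C3 C5 g1 g2 g3 by (intro mult_mono mult_nonneg_nonneg) auto
    also have "\<dots> = (C5 * C1 * C2 * C3) *
        (exp (Re z) * exp (c / \<eta> * Re z) * exp (Re z) * exp (- \<kappa> * Re z) * exp (ln x * Re z))"
      by (simp only: mult_ac)
    also have "exp (Re z) * exp (c / \<eta> * Re z) * exp (Re z) * exp (- \<kappa> * Re z) * exp (ln x * Re z)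
        = exp (- Re z)"
      unfolding exp_add[symmetric] by (simp add: \<kappa>_def algebra_simps)
    finally show ?thesis .
  qed
  then show ?thesis
    by (intro exI[of _ K] exI[of _ "C5 * C1 * C2 * C3"]) simp
qed

lemma continuous_on_F_norm:
  assumes "0 < x" "0 < M" "0 < N"
  shows "continuous_on (Gplus_contour \<delta>) (\<lambda>z. F_norm \<alpha> \<eta> \<theta> M N s z * complex_of_real x powr z)"
proof -
  have c: "continuous_on S (gamma_arg \<alpha> \<theta>)" "continuous_on S (\<lambda>z. gamma_arg \<alpha> \<eta> (- z))" for S
    using pos by (auto simp: gamma_arg_def[abs_def] intro!: continuous_intros)
  have p: "continuous_on S (\<lambda>z. pochhammer (f z) n)" if "continuous_on S f"
    for S n and f :: "complex \<Rightarrow> complex"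
    unfolding pochhammer_prod by (intro continuous_intros that)
  show ?thesis
    unfolding F_norm_def shift_factor_def Gamma_series'_def
    using pochhammer_gamma_arg_nonzero pos assms
    by (intro continuous_intros c p) auto
qed

lemma F_norm_tendsto:
  assumes "filterlim M at_top sequentially" "filterlim N at_top sequentially"
    and z: "z \<in> Gplus_contour \<delta>"
  shows "(\<lambda>k. F_norm \<alpha> \<eta> \<theta> (M k) (N k) s z) \<longlonglongrightarrow> F_he \<alpha> \<eta> \<theta> s z"
proof -
  let ?a = "gamma_arg \<alpha> \<theta> z" and ?b = "gamma_arg \<alpha> \<eta> (- z)"
  let ?m = "nat (npart s)" and ?p = "nat (ppart s)"
  note ni = gamma_arg_notin_nonpos_Ints[OF z]
  \<comment> \<open>\<open>Gamma\<close> has the default value 0 at its poles and vanishes nowhere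
    else, so the denominator has a nonzero limit.\<close>
  have "Gamma ?a \<noteq> 0"
    using ni by (simp add: Gamma_eq_zero_iff)
  then have "(\<lambda>k. F_norm \<alpha> \<eta> \<theta> (M k) (N k) s z) \<longlonglongrightarrow> shift_factor \<alpha> \<eta> \<theta> s z * Gamma ?b / Gamma ?a"
    unfolding F_norm_def
    by (intro tendsto_intros filterlim_compose[OF Gamma_series'_LIMSEQ] assms)
  also have "shift_factor \<alpha> \<eta> \<theta> s z * Gamma ?b / Gamma ?a = F_he \<alpha> \<eta> \<theta> s z"
  proof -
    have eq: "complex_of_real (\<alpha> / (2*\<eta>)) - z / complex_of_real \<eta> + of_int (npart s) + 1/2 = ?b + of_nat ?m"
      "complex_of_real (\<alpha> / (2*\<theta>)) + z / complex_of_real \<theta> + of_int (ppart s) + 1/2 = ?a + of_nat ?p"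
      by (auto simp: gamma_arg_def npart_def ppart_def)
    have "Gamma (?b + of_nat ?m) = pochhammer ?b ?m * Gamma ?b"
      "Gamma (?a + of_nat ?p) = pochhammer ?a ?p * Gamma ?a"
      using ni by (simp_all add: pochhammer_Gamma Gamma_eq_zero_iff)
    moreover have "\<eta> powi npart s = \<eta> ^ ?m" "\<theta> powi ppart s = \<theta> ^ ?p"
      by (simp_all add: power_int_def npart_def ppart_def)
    ultimately show ?thesis
      unfolding F_he_def eq shift_factor_def by (simp add: mult_ac)
  qed
  finally show ?thesis .
qed

text \<open>Completing the truncated Pochhammer symbols produces the shift factor, and L^-z is
  absorbed by the powers of M and N inside Gauss's products.\<close>

lemma F_c_times_powr:
  assumes MN: "0 < M" "0 < N" "nat (npart s) \<le> M" "nat (ppart s) \<le> N"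
    and "0 < x" and z: "z \<in> Gplus_contour \<delta>"
  shows "F_c \<alpha> \<eta> \<theta> M N s z * complex_of_real (x / (real M powr (1/\<eta>) * real N powr (1/\<theta>))) powr z
    = of_real (F_scale \<alpha> \<eta> \<theta> M N) * (F_norm \<alpha> \<eta> \<theta> M N s z * complex_of_real x powr z)"
proof -
  let ?a = "gamma_arg \<alpha> \<theta> z" and ?b = "gamma_arg \<alpha> \<eta> (- z)"
  let ?m = "nat (npart s)" and ?p = "nat (ppart s)"
  let ?L = "real M powr (1/\<eta>) * real N powr (1/\<theta>)"
  \<comment> \<open>With a and b the two Gamma arguments, N^a = A * e and M^b = B / f:
    \<open>A\<close>, \<open>B\<close> do not depend on z, and e * f = L^z.\<close>
  define A where "A = real N powr (\<alpha> / (2*\<theta>) + 1/2)"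
  define B where "B = real M powr (\<alpha> / (2*\<eta>) + 1/2)"
  define e where "e = exp (z / of_real \<theta> * of_real (ln N))"
  define f where "f = exp (z / of_real \<eta> * of_real (ln M))"
  have nz: "pochhammer ?b n \<noteq> 0" "pochhammer ?a n \<noteq> 0" for n
    using pochhammer_gamma_arg_nonzero[OF z] by auto
  have eq: "complex_of_real (\<alpha> / (2*\<eta>)) - z / complex_of_real \<eta> + of_int (npart s) + 1/2 = ?b + of_nat ?m"
    "complex_of_real (\<alpha> / (2*\<theta>)) + z / complex_of_real \<theta> + of_int (ppart s) + 1/2 = ?a + of_nat ?p"
    by (auto simp: gamma_arg_def npart_def ppart_def)
  have n: "int N - ppart s = int (N - ?p)" "int M - npart s = int (M - ?m)"
    using MN by (auto simp: npart_def ppart_def)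
  have th: "\<theta> powi (int N - ppart s) = \<theta> ^ N / \<theta> ^ ?p" "\<eta> powi (int M - npart s) = \<eta> ^ M / \<eta> ^ ?m"
    unfolding n power_int_of_nat using MN pos by (simp_all add: power_diff)
  have ph: "pochhammer (?a + of_nat ?p) (nat (int N - ppart s)) = pochhammer ?a N / pochhammer ?a ?p"
    "pochhammer (?b + of_nat ?m) (nat (int M - npart s)) = pochhammer ?b M / pochhammer ?b ?m"
    unfolding n nat_int pochhammer_product[OF MN(4), of ?a] pochhammer_product[OF MN(3), of ?b]
    using nz by simp_all
  have ea: "exp (?a * of_real (ln N)) = of_real A * e"
  proof -
    have "of_real A = exp (complex_of_real ((\<alpha> / (2*\<theta>) + 1/2) * ln N))"
      unfolding exp_of_real using MN by (simp add: A_def powr_def)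
    then show ?thesis
      unfolding e_def by (simp add: exp_add[symmetric] gamma_arg_def algebra_simps)
  qed
  have eb: "exp (?b * of_real (ln M)) = of_real B / f"
  proof -
    have "of_real B = exp (complex_of_real ((\<alpha> / (2*\<eta>) + 1/2) * ln M))"
      unfolding exp_of_real using MN by (simp add: B_def powr_def)
    then show ?thesis
      unfolding f_def by (simp add: exp_diff[symmetric] gamma_arg_def algebra_simps)
  qed
  have L: "0 < ?L" using MN by simp
  have "complex_of_real (x / ?L) powr z = exp (z * of_real (ln (x / ?L)))"
    using L \<open>0 < x\<close> by (intro of_real_powr_eq_exp_ln) simp
  also have "ln (x / ?L) = ln x - (ln M / \<eta> + ln N / \<theta>)"
    using L \<open>0 < x\<close> MN by (simp add: ln_div ln_mult ln_powr)
  also have "exp (z * of_real (ln x - (ln M / \<eta> + ln N / \<theta>))) = exp (z * of_real (ln x)) / (e * f)"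
    unfolding e_def f_def exp_add[symmetric] exp_diff[symmetric] by (simp add: algebra_simps)
  also have "exp (z * of_real (ln x)) = complex_of_real x powr z"
    using \<open>0 < x\<close> by (simp add: of_real_powr_eq_exp_ln)
  finally have xL: "complex_of_real (x / ?L) powr z = complex_of_real x powr z / (e * f)" .
  \<comment> \<open>Here \<open>a\<close> and \<open>b\<close> stand for the factorials; like
    \<open>A\<close> and \<open>B\<close> they cancel between \<open>F_scale\<close> and Gauss's
    products.\<close>
  have algebra: "(T / T') / (H / H') * (P / P') / (Q / Q') * (X / (e * f)) = (T * a * A) / (H * b * B)
      * ((H' * Q') / (T' * P') * (b * (B / f) / Q) / (a * (A * e) / P) * X)"
    if "a \<noteq> 0" "b \<noteq> 0" "A \<noteq> 0" "B \<noteq> 0" for T T' H H' P P' Q Q' X e f a b A B :: complex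
    using that by (simp, simp add: mult_ac)
  have "0 < A" "0 < B"
    using MN by (auto simp: A_def B_def)
  then show ?thesis
    unfolding F_c_def eq th ph xL F_scale_def F_norm_def shift_factor_def Gamma_series'_def ea eb
      A_def[symmetric] B_def[symmetric]
    unfolding of_real_mult of_real_divide of_real_power of_real_fact
    by (intro algebra) simp_all
qed

end

section \<open>Symmetry, rescaling and passage to the limit\<close>

lemma ppart_uminus: "ppart (- s) = npart s" and npart_uminus: "npart (- s) = ppart s"
  by (simp_all add: ppart_def npart_def)

text \<open>Inversion swaps numerator and denominator, negating the argument swaps the signs in the
  two Gamma arguments, and negating t swaps its positive and negative parts; together they exchange
  (\<eta>, M) and (\<theta>, N).\<close>

lemma inverse_F_c: "inverse (F_c \<alpha> \<eta> \<theta> M N t (- w)) = F_c \<alpha> \<theta> \<eta> N M (- t) w"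
  by (simp add: F_c_def ppart_uminus npart_uminus)

lemma inverse_F_he: "inverse (F_he \<alpha> \<eta> \<theta> t (- w)) = F_he \<alpha> \<theta> \<eta> (- t) w"
  by (simp add: F_he_def ppart_uminus npart_uminus)

lemma inverse_sqrt_rescale:
  assumes "0 < L"
  shows "complex_of_real (1 / L) * complex_of_real (1 / sqrt (x / L * (y / L))) =
    complex_of_real (1 / sqrt (x * y))"
proof -
  have "sqrt (x / L * (y / L)) = sqrt (x * y) / L"
    using assms by (simp add: real_sqrt_divide)
  then show ?thesis
    using assms by (simp flip: of_real_mult)
qed

text \<open>Apart from its prefactor \<open>V_c\<close> depends on x and y only through x / y, so
  this term is the same before and after the limit.\<close>

lemma V_c_rescale:
  assumes "0 < L" "0 < x" "0 < y"
  shows "complex_of_real (1 / L) * V_c \<alpha> \<eta> \<theta> s (x / L) t (y / L) = V_c \<alpha> \<eta> \<theta> s x t y"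
proof -
  note pre = inverse_sqrt_rescale[OF assms(1), of x y]
  have quot: "(x / L) / (y / L) = x / y" "(x / L > y / L) = (x > y)"
    using assms by (simp_all add: divide_less_cancel)
  have assoc: "p * (q / k * X) = r / k * X" if "p * q = r" for p q r k X :: complex
    using that by auto
  show ?thesis
  proof (cases "s \<le> t")
    case False
    show ?thesis
      unfolding V_c_def Let_def quot if_not_P[OF False] by (rule assoc[OF pre])
  qed (simp add: V_c_def)
qed

text \<open>Dominated convergence speaks of sequences. If the limit failed along the product filter,
  bad pairs beyond every k would form sequences violating the assumption.\<close>

lemma tendsto_prod_sequentiallyI:
  fixes f :: "nat \<times> nat \<Rightarrow> 'a::metric_space"
  assumes "\<And>M N. filterlim M at_top sequentially \<Longrightarrow> filterlim N at_top sequentially \<Longrightarrow>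
    (\<And>k. K \<le> M k) \<Longrightarrow> (\<And>k. K \<le> N k) \<Longrightarrow> (\<lambda>k. f (M k, N k)) \<longlonglongrightarrow> l"
  shows "(f \<longlongrightarrow> l) (sequentially \<times>\<^sub>F sequentially)"
proof (rule ccontr)
  assume "\<not> ?thesis"
  then obtain e where "e > 0" and e: "\<not> eventually (\<lambda>p. dist (f p) l < e) (sequentially \<times>\<^sub>F sequentially)"
    unfolding tendsto_iff by blast
  have "\<exists>m n. k \<le> m \<and> k \<le> n \<and> e \<le> dist (f (m, n)) l" for k
    using e unfolding eventually_prod_sequentially by (meson not_less)
  then obtain M N where MN: "\<And>k. k \<le> M k" "\<And>k. k \<le> N k" "\<And>k. e \<le> dist (f (M k, N k)) l"
    by metis
  have lim: "filterlim (\<lambda>k. g (k + K)) at_top sequentially" if "\<And>k. k \<le> g k" for g :: "nat \<Rightarrow> nat"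
    by (rule filterlim_at_top_mono[OF filterlim_ident])
      (auto intro!: always_eventually order_trans[OF _ that])
  \<comment> \<open>Shifting the index by \<open>K\<close> keeps both sequences above the
    threshold.\<close>
  have "(\<lambda>k. f (M (k + K), N (k + K))) \<longlonglongrightarrow> l"
    using MN(1,2) by (intro assms lim) (auto intro: order_trans[OF le_add2])
  then have "eventually (\<lambda>k. dist (f (M (k + K), N (k + K))) l < e) sequentially"
    using \<open>e > 0\<close> by (rule tendstoD)
  then show False
    using MN(3) by (auto simp: eventually_sequentially not_less[symmetric])
qed

theorem mainTheorem4:
  fixes \<alpha> \<eta> \<theta> \<delta> x y :: real and s t :: int
  assumes "\<alpha> \<ge> 0" and "\<eta> > 0" and "\<theta> > 0"
    and "0 < \<delta>" and "\<delta> < (\<alpha> + min \<eta> \<theta>) / 2"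
    and "x > 0" and "y > 0"
  shows "((\<lambda>(M, N). let L = real M powr (1/\<eta>) * real N powr (1/\<theta>) in
            complex_of_real (1 / L) * K_c \<alpha> \<eta> \<theta> \<delta> M N s (x / L) t (y / L))
          \<longlongrightarrow> K_he \<alpha> \<eta> \<theta> \<delta> s x t y)
         (inf (at_top \<times>\<^sub>F at_top) (principal {(M, N). 1 \<le> M \<and> M \<le> N}))"
proof -
  note A = assms(1-5)
  have A': "0 \<le> \<alpha>" "0 < \<theta>" "0 < \<eta>" "0 < \<delta>" "\<delta> < (\<alpha> + min \<theta> \<eta>) / 2"
    using A by (simp_all add: min.commute)
  obtain K1 C where K1: "\<And>M N z. 0 < M \<Longrightarrow> K1 \<le> N \<Longrightarrow> z \<in> Gplus_contour \<delta> \<Longrightarrow>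
      norm (F_norm \<alpha> \<eta> \<theta> M N s z * complex_of_real x powr z) \<le> C * exp (- Re z)"
    using F_norm_bound[OF A assms(6), of s] by blast
  \<comment> \<open>The same bound for 1 / F_c(t, -w), which is the exchanged factor at -t.\<close>
  obtain K2 D where K2: "\<And>M N z. 0 < M \<Longrightarrow> K2 \<le> N \<Longrightarrow> z \<in> Gplus_contour \<delta> \<Longrightarrow>
      norm (F_norm \<alpha> \<theta> \<eta> M N (- t) z * complex_of_real y powr z) \<le> D * exp (- Re z)"
    using F_norm_bound[OF A' assms(7), of "- t"] by blast
  \<comment> \<open>The summands ensure positive indices, the two uniform bounds, and exact
    truncated subtraction in \<open>F_c\<close> at s and t.\<close>
  define K where "K = 1 + K1 + K2 + nat \<bar>s\<bar> + nat \<bar>t\<bar>"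
  define f where "f = (\<lambda>M N z. F_norm \<alpha> \<eta> \<theta> M N s z * complex_of_real x powr z)"
  define g where "g = (\<lambda>M N z. F_norm \<alpha> \<theta> \<eta> N M (- t) z * complex_of_real y powr z)"
  define I where "I = (\<lambda>f g. Gplus_integral \<delta> (\<lambda>z. Gplus_integral \<delta> (\<lambda>w. f z * g w / (z + w))))"
  let ?pre = "complex_of_real (1 / sqrt (x*y))"
  have K_c_eq: "(let L = real M powr (1/\<eta>) * real N powr (1/\<theta>) in
        complex_of_real (1 / L) * K_c \<alpha> \<eta> \<theta> \<delta> M N s (x / L) t (y / L)) =
      ?pre * I (f M N) (g M N) / (2 * complex_of_real pi * \<i>)^2 - V_c \<alpha> \<eta> \<theta> s x t y"
    if MN: "K \<le> M" "K \<le> N" for M N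
  proof -
    define L where "L = real M powr (1/\<eta>) * real N powr (1/\<theta>)"
    have MN0: "0 < M" "0 < N"
      using MN by (auto simp: K_def)
    have part: "nat (npart r) \<le> M" "nat (ppart r) \<le> N" "nat (npart r) \<le> N" "nat (ppart r) \<le> M"
      if "r = s \<or> r = t" for r
    proof -
      have "nat (npart r) \<le> nat \<bar>r\<bar>" "nat (ppart r) \<le> nat \<bar>r\<bar>"
        by (auto simp: npart_def ppart_def intro!: nat_mono)
      moreover have "nat \<bar>r\<bar> \<le> K"
        using that by (auto simp: K_def)
      ultimately show "nat (npart r) \<le> M" "nat (ppart r) \<le> N" "nat (npart r) \<le> N" "nat (ppart r) \<le> M"
        using MN by linarith+
    qed
    have L: "0 < L" using MN0 by (auto simp: L_def)
    \<comment> \<open>The constants of the two factors are reciprocal to each other, so they leave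
      the kernel.\<close>
    have "F_scale \<alpha> \<eta> \<theta> M N * F_scale \<alpha> \<theta> \<eta> N M = 1"
      using MN0 assms by (simp add: F_scale_def)
    then have scale: "complex_of_real (F_scale \<alpha> \<eta> \<theta> M N) * complex_of_real (F_scale \<alpha> \<theta> \<eta> N M) = 1"
      by (simp flip: of_real_mult)
    have pt: "F_c \<alpha> \<eta> \<theta> M N s z / F_c \<alpha> \<eta> \<theta> M N t (- w)
          * complex_of_real (x / L) powr z / complex_of_real (y / L) powr (- w) / (z - - w)
        = f M N z * g M N w / (z + w)"
      if z: "z \<in> Gplus_contour \<delta>" and w: "w \<in> Gplus_contour \<delta>" for z w
    proof -
      have L': "L = real N powr (1/\<theta>) * real M powr (1/\<eta>)"
        by (simp add: L_def)
      have "F_c \<alpha> \<eta> \<theta> M N s z / F_c \<alpha> \<eta> \<theta> M N t (- w)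
          * complex_of_real (x / L) powr z / complex_of_real (y / L) powr (- w) / (z - - w)
        = (F_c \<alpha> \<eta> \<theta> M N s z * complex_of_real (x / L) powr z)
          * (inverse (F_c \<alpha> \<eta> \<theta> M N t (- w)) * complex_of_real (y / L) powr w) / (z + w)"
        by (simp add: powr_minus divide_inverse mult_ac)
      also have "F_c \<alpha> \<eta> \<theta> M N s z * complex_of_real (x / L) powr z =
          of_real (F_scale \<alpha> \<eta> \<theta> M N) * f M N z"
        unfolding L_def f_def
        by (rule F_c_times_powr[OF A _ _ _ _ assms(6) z]) (use MN0 part in auto)
      also have "inverse (F_c \<alpha> \<eta> \<theta> M N t (- w)) * complex_of_real (y / L) powr w =
          of_real (F_scale \<alpha> \<theta> \<eta> N M) * g M N w"
        unfolding L' g_def inverse_F_c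
        by (rule F_c_times_powr[OF A' _ _ _ _ assms(7) w])
          (use MN0 part in \<open>auto simp: ppart_uminus npart_uminus\<close>)
      also have "of_real (F_scale \<alpha> \<eta> \<theta> M N) * f M N z * (of_real (F_scale \<alpha> \<theta> \<eta> N M) * g M N w)
          = (of_real (F_scale \<alpha> \<eta> \<theta> M N) * of_real (F_scale \<alpha> \<theta> \<eta> N M)) * (f M N z * g M N w)"
        by (simp only: mult_ac)
      finally show ?thesis
        unfolding scale by simp
    qed
    have int: "Gplus_integral \<delta> (\<lambda>\<zeta>. Gminus_integral \<delta> (\<lambda>\<omega>.
          F_c \<alpha> \<eta> \<theta> M N s \<zeta> / F_c \<alpha> \<eta> \<theta> M N t \<omega>
          * complex_of_real (x / L) powr \<zeta> / complex_of_real (y / L) powr \<omega> / (\<zeta> - \<omega>))) = I (f M N) (g M N)"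
      unfolding Gminus_integral_eq_Gplus_integral I_def
      by (intro Gplus_integral_cong assms(4) pt)
    have distrib: "p * (q * J / k - v) = r * J / k - p * v" if "p * q = r" for p q r J k v :: complex
      using that by (simp add: right_diff_distrib mult.assoc[symmetric])
    show ?thesis
      unfolding L_def[symmetric] Let_def K_c_def int distrib[OF inverse_sqrt_rescale[OF L]]
        V_c_rescale[OF L assms(6,7)] ..
  qed
  \<comment> \<open>\<open>F_he\<close> has the same exchange symmetry, so the limit kernel is also
    expressed through \<open>I\<close>.\<close>
  have K_he_eq: "K_he \<alpha> \<eta> \<theta> \<delta> s x t y = ?pre * I (\<lambda>z. F_he \<alpha> \<eta> \<theta> s z * complex_of_real x powr z)
      (\<lambda>w. F_he \<alpha> \<theta> \<eta> (- t) w * complex_of_real y powr w) / (2 * complex_of_real pi * \<i>)^2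
      - V_c \<alpha> \<eta> \<theta> s x t y"
    unfolding K_he_def Gminus_integral_eq_Gplus_integral I_def inverse_F_he[symmetric]
    by (simp add: powr_minus divide_inverse mult_ac)
  have "((\<lambda>(M, N). let L = real M powr (1/\<eta>) * real N powr (1/\<theta>) in
            complex_of_real (1 / L) * K_c \<alpha> \<eta> \<theta> \<delta> M N s (x / L) t (y / L))
          \<longlongrightarrow> K_he \<alpha> \<eta> \<theta> \<delta> s x t y) (sequentially \<times>\<^sub>F sequentially)"
  proof (rule tendsto_prod_sequentiallyI[of K])
    fix M N :: "nat \<Rightarrow> nat"
    assume lim: "filterlim M at_top sequentially" "filterlim N at_top sequentially"
      and K: "\<And>k. K \<le> M k" "\<And>k. K \<le> N k"
    have MN0: "0 < M k" "0 < N k" "K1 \<le> N k" "K2 \<le> M k" for k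
      using K[of k] by (auto simp: K_def)
    have "(\<lambda>k. I (f (M k) (N k)) (g (M k) (N k))) \<longlonglongrightarrow>
        I (\<lambda>z. F_he \<alpha> \<eta> \<theta> s z * complex_of_real x powr z)
          (\<lambda>w. F_he \<alpha> \<theta> \<eta> (- t) w * complex_of_real y powr w)"
      unfolding I_def f_def g_def
      by (intro Gplus_double_integral_tendsto[OF assms(4), where C = C and D = D] continuous_on_F_norm[OF A] K1 K2
          continuous_on_F_norm[OF A'] tendsto_mult_right F_norm_tendsto[OF A] F_norm_tendsto[OF A']
          MN0 lim assms)
    then have "(\<lambda>k. ?pre * I (f (M k) (N k)) (g (M k) (N k)) / (2 * complex_of_real pi * \<i>)^2
        - V_c \<alpha> \<eta> \<theta> s x t y) \<longlonglongrightarrow> K_he \<alpha> \<eta> \<theta> \<delta> s x t y"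
      unfolding K_he_eq by (intro tendsto_intros) auto
    then show "(\<lambda>k. case (M k, N k) of (M, N) \<Rightarrow> let L = real M powr (1/\<eta>) * real N powr (1/\<theta>) in
        complex_of_real (1 / L) * K_c \<alpha> \<eta> \<theta> \<delta> M N s (x / L) t (y / L)) \<longlonglongrightarrow> K_he \<alpha> \<eta> \<theta> \<delta> s x t y"
      using K_c_eq[OF K] by simp
  qed
  \<comment> \<open>The filter of the theorem is finer than the product filter, so the limit carries
    over.\<close>
  then show ?thesis
    by (rule tendsto_mono[OF inf_le1])
qed

end
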